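(* Let $\lambda_1,\dots,\lambda_n$ be distinct points in $\mathbb{D}$, let $(x_{1j},x_{2j},x_{3j})\in\overline{\mathcal{E}}$ be such that $x_{1j}x_{2j}\neq x_{3j}$ for $j=1,\dots,n$, and let $z_1,z_2,z_3$ be distinct points in $\mathbb{D}$. Let $x\in\mathrm{Hol}(\mathbb{D},\overline{\mathcal{E}})$ satisfy $x(\lambda_j)=(x_{1j},x_{2j},x_{3j})$ for $j=1,\dots,n$. Then $x$ arises by Procedure SW from a solution $(N,M)$ of the corresponding inequality with $\operatorname{rank}N\le1$; that is, there exist positive $3n$-square matrices $N=[N_{il,jk}]_{i,j=1,\,l,k=1}^{n,3}$ and $M=[M_{il,jk}]_{i,j=1,\,l,k=1}^{n,3}$ such that $\operatorname{rank}N\le 1$ and $$\left[1-\overline{\Psi(z_l,x_{1i},x_{2i},x_{3i})}\,\Psi(z_k,x_{1j},x_{2j},x_{3j})\right]\ \ge\ \left[(1-\overline{z_l}z_k)N_{il,jk}\right]+\left[(1-\overline{\lambda_i}\lambda_j)M_{il,jk}\right],$$ and such that, with suitable choices in steps (1)–(3) of Procedure SW applied to $(N,M)$, the function produced in step (4) is $x$.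
   Context: $\mathbb{D}$ is the open unit disc. The closed tetrablock is $\overline{\mathcal{E}}=\{(x_1,x_2,x_3)\in\mathbb{C}^3:1-x_1z-x_2w+x_3zw\neq 0\text{ for all }z,w\in\mathbb{D}\}$; $\mathrm{Hol}(\mathbb{D},\overline{\mathcal{E}})$ is the set of analytic maps from $\mathbb{D}$ to $\overline{\mathcal{E}}$. $\Psi(z,x_1,x_2,x_3)=\dfrac{x_3z-x_1}{x_2z-1}$ for $x_2z\ne1$. "Positive" means positive semidefinite; rows of the $3n$-square matrices are indexed by $(i,l)$ and columns by $(j,k)$; $P\ge Q$ means $P-Q$ is positive semidefinite. Procedure SW. Given the data $\lambda_j$, $(x_{1j},x_{2j},x_{3j})$, $z_1,z_2,z_3$ and a pair $(N,M)$ of positive $3n$-square matrices with $\operatorname{rank}N\le1$ satisfying the displayed inequality: (1) choose scalars $\gamma_{jk}\in\mathbb{C}$ such that $N_{il,jk}=\overline{\gamma_{il}}\gamma_{jk}$ for all $i,j,l,k$; (2) choose a Hilbert space $\mathcal{M}$ and vectors $v_{jk}\in\mathcal{M}$ such that $M_{il,jk}=\langle v_{jk},v_{il}\rangle_{\mathcal{M}}$ for all $i,j,l,k$; (3) choose a contraction $\begin{bmatrix}A&B\\ C&D\end{bmatrix}:\mathbb{C}^2\oplus\mathcal{M}\to\mathbb{C}^2\oplus\mathcal{M}$ such that $$\begin{bmatrix}A&B\\ C&D\end{bmatrix}\begin{pmatrix}1\\ z_k\gamma_{jk}\\ \lambda_j v_{jk}\end{pmatrix}=\begin{pmatrix}\Psi(z_k,x_{1j},x_{2j},x_{3j})\\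 \gamma_{jk}\\ v_{jk}\end{pmatrix}\quad\text{for }j=1,\dots,n,\ k=1,2,3;$$ (4) let $\Theta(\lambda)=A+B\lambda(I-D\lambda)^{-1}C$ (a $2\times2$ matrix function on $\mathbb{D}$); the function produced is $\lambda\mapsto(\Theta_{11}(\lambda),\Theta_{22}(\lambda),\det\Theta(\lambda))$, $\lambda\in\mathbb{D}$. *)

theory Defs
  imports "HOL-Analysis.Analysis" "HOL-Algebra.Module"
begin

abbreviation unit_disc :: "complex set" where
  "unit_disc \<equiv> ball 0 1"

definition closed_tetrablock :: "(complex \<times> complex \<times> complex) set" where
  "closed_tetrablock =
    {(x1, x2, x3). \<forall>z\<in>unit_disc. \<forall>w\<in>unit_disc. 1 - x1 * z - x2 * w + x3 * z * w \<noteq> 0}"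

definition Hol_tetrablock :: "(complex \<Rightarrow> complex \<times> complex \<times> complex) set" where
  "Hol_tetrablock =
    {x. (\<lambda>l. fst (x l)) holomorphic_on unit_disc \<and>
        (\<lambda>l. fst (snd (x l))) holomorphic_on unit_disc \<and>
        (\<lambda>l. snd (snd (x l))) holomorphic_on unit_disc \<and>
        x ` unit_disc \<subseteq> closed_tetrablock}"

definition Psi :: "complex \<Rightarrow> complex \<Rightarrow> complex \<Rightarrow> complex \<Rightarrow> complex" where
  "Psi z x1 x2 x3 = (x3 * z - x1) / (x2 * z - 1)"

text \<open>Over the complex numbers, a matrix whose quadratic form takes only nonnegative real
  values is automatically Hermitian.\<close>

definition pos_semidef :: "complex ^ 'a ^ 'a \<Rightarrow> bool" where
  "pos_semidef P \<longleftrightarrow>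
    (\<forall>u :: complex ^ 'a. (\<Sum>p\<in>UNIV. \<Sum>q\<in>UNIV. cnj (u $ p) * P $ p $ q * u $ q) \<in> \<real>\<^sub>\<ge>\<^sub>0)"

definition loewner_ge :: "complex ^ 'a ^ 'a \<Rightarrow> complex ^ 'a ^ 'a \<Rightarrow> bool" where
  "loewner_ge P Q \<longleftrightarrow> pos_semidef (P - Q)"

text \<open>The matrix whose entry in row \<open>(i, l)\<close> and column \<open>(j, k)\<close> is \<open>f i l j k\<close>; the indices
  \<open>1, \<dots>, n\<close> are the elements of a finite type \<open>'n\<close> and the indices \<open>1, 2, 3\<close> those of the
  numeral type \<open>3\<close>.\<close>

definition index_matrix ::
    "('n::finite \<Rightarrow> 3 \<Rightarrow> 'n \<Rightarrow> 3 \<Rightarrow> complex) \<Rightarrow> complex ^ ('n \<times> 3) ^ ('n \<times> 3)" where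
  "index_matrix f = (\<chi> p q. f (fst p) (snd p) (fst q) (snd q))"

text \<open>Complex Hilbert spaces with explicit carriers, so that one can quantify over Hilbert spaces
  inside a formula. Elements of type \<open>nat \<Rightarrow> complex\<close> suffice to represent every separable Hilbert
  space up to isomorphism. The fields \<open>mult\<close> and \<open>one\<close> that the record type of modules inherits from
  rings are not constrained. The inner product is linear in its first argument.\<close>

definition complex_ring :: "complex ring" where
  "complex_ring = \<lparr>carrier = UNIV, mult = (*), one = 1, zero = 0, add = (+)\<rparr>"

record 'm inner_module = "(complex, 'm) module" +
  ip :: "'m \<Rightarrow> 'm \<Rightarrow> complex"

definition hnorm :: "('m, 'b) inner_module_scheme \<Rightarrow> 'm \<Rightarrow> real" where
  "hnorm H v = sqrt (Re (ip H v v))"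

locale hilbert_space = module complex_ring H for H (structure) +
  assumes ip_add_left:
      "\<lbrakk>x \<in> carrier H; y \<in> carrier H; w \<in> carrier H\<rbrakk> \<Longrightarrow> ip H (x \<oplus>\<^bsub>H\<^esub> y) w = ip H x w + ip H y w"
    and ip_smult_left:
      "\<lbrakk>x \<in> carrier H; w \<in> carrier H\<rbrakk> \<Longrightarrow> ip H (a \<odot>\<^bsub>H\<^esub> x) w = a * ip H x w"
    and ip_cnj:
      "\<lbrakk>x \<in> carrier H; y \<in> carrier H\<rbrakk> \<Longrightarrow> ip H y x = cnj (ip H x y)"
    and ip_nonneg:
      "x \<in> carrier H \<Longrightarrow> ip H x x \<in> \<real>\<^sub>\<ge>\<^sub>0"
    and ip_definite:
      "\<lbrakk>x \<in> carrier H; ip H x x = 0\<rbrakk> \<Longrightarrow> x = \<zero>\<^bsub>H\<^esub>"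
    and complete:
      "\<lbrakk>range s \<subseteq> carrier H; \<forall>e>0. \<exists>K. \<forall>m\<ge>K. \<forall>n\<ge>K. hnorm H (s m \<ominus>\<^bsub>H\<^esub> s n) < e\<rbrakk>
        \<Longrightarrow> \<exists>x\<in>carrier H. (\<lambda>n. hnorm H (s n \<ominus>\<^bsub>H\<^esub> x)) \<longlonglongrightarrow> 0"

text \<open>An operator on \<open>\<complex>\<^sup>2 \<oplus> H\<close> is given by its blocks: a matrix \<open>A\<close> and maps \<open>B\<close>, \<open>C\<close>, \<open>D\<close>
  between \<open>\<complex>\<^sup>2\<close> and \<open>H\<close>, of which only the values on \<open>carrier H\<close> matter.\<close>

definition linear_blocks ::
    "'m inner_module \<Rightarrow> ('m \<Rightarrow> complex ^ 2) \<Rightarrow> (complex ^ 2 \<Rightarrow> 'm) \<Rightarrow> ('m \<Rightarrow> 'm) \<Rightarrow> bool" where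
  "linear_blocks H B C D \<longleftrightarrow>
    (\<forall>x\<in>carrier H. \<forall>y\<in>carrier H. B (x \<oplus>\<^bsub>H\<^esub> y) = B x + B y) \<and>
    (\<forall>a. \<forall>x\<in>carrier H. B (a \<odot>\<^bsub>H\<^esub> x) = a *s B x) \<and>
    (\<forall>u. C u \<in> carrier H) \<and>
    (\<forall>u v. C (u + v) = C u \<oplus>\<^bsub>H\<^esub> C v) \<and>
    (\<forall>a u. C (a *s u) = a \<odot>\<^bsub>H\<^esub> C u) \<and>
    (\<forall>x\<in>carrier H. D x \<in> carrier H) \<and>
    (\<forall>x\<in>carrier H. \<forall>y\<in>carrier H. D (x \<oplus>\<^bsub>H\<^esub> y) = D x \<oplus>\<^bsub>H\<^esub> D y) \<and>
    (\<forall>a. \<forall>x\<in>carrier H. D (a \<odot>\<^bsub>H\<^esub> x) = a \<odot>\<^bsub>H\<^esub> D x)"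

definition block_op ::
    "'m inner_module \<Rightarrow> complex ^ 2 ^ 2 \<Rightarrow> ('m \<Rightarrow> complex ^ 2) \<Rightarrow> (complex ^ 2 \<Rightarrow> 'm) \<Rightarrow> ('m \<Rightarrow> 'm)
      \<Rightarrow> (complex ^ 2) \<times> 'm \<Rightarrow> (complex ^ 2) \<times> 'm" where
  "block_op H A B C D = (\<lambda>(u, m). (A *v u + B m, C u \<oplus>\<^bsub>H\<^esub> D m))"

definition sum_norm :: "'m inner_module \<Rightarrow> (complex ^ 2) \<times> 'm \<Rightarrow> real" where
  "sum_norm H = (\<lambda>(u, m). sqrt ((norm u)\<^sup>2 + (hnorm H m)\<^sup>2))"

definition contraction_blocks ::
    "'m inner_module \<Rightarrow> complex ^ 2 ^ 2 \<Rightarrow> ('m \<Rightarrow> complex ^ 2) \<Rightarrow> (complex ^ 2 \<Rightarrow> 'm) \<Rightarrow> ('m \<Rightarrow> 'm)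
      \<Rightarrow> bool" where
  "contraction_blocks H A B C D \<longleftrightarrow>
    linear_blocks H B C D \<and>
    (\<forall>w \<in> UNIV \<times> carrier H. sum_norm H (block_op H A B C D w) \<le> sum_norm H w)"

text \<open>\<open>\<Theta>(\<lambda>) = A + B \<lambda> (I - D \<lambda>)\<^sup>-\<^sup>1 C\<close> as a matrix. For a contraction and \<open>\<bar>\<lambda>\<bar> < 1\<close> the map
  \<open>I - D \<lambda>\<close> is a bijection of \<open>carrier H\<close>.\<close>

definition Theta ::
    "'m inner_module \<Rightarrow> complex ^ 2 ^ 2 \<Rightarrow> ('m \<Rightarrow> complex ^ 2) \<Rightarrow> (complex ^ 2 \<Rightarrow> 'm) \<Rightarrow> ('m \<Rightarrow> 'm)
      \<Rightarrow> complex \<Rightarrow> complex ^ 2 ^ 2" where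
  "Theta H A B C D l =
    A + matrix (\<lambda>u. B (l \<odot>\<^bsub>H\<^esub> inv_into (carrier H) (\<lambda>m. m \<ominus>\<^bsub>H\<^esub> D (l \<odot>\<^bsub>H\<^esub> m)) (C u)))"

definition SW_solution ::
    "('n::finite \<Rightarrow> complex) \<Rightarrow> ('n \<Rightarrow> complex) \<Rightarrow> ('n \<Rightarrow> complex) \<Rightarrow> ('n \<Rightarrow> complex) \<Rightarrow> (3 \<Rightarrow> complex)
      \<Rightarrow> complex ^ ('n \<times> 3) ^ ('n \<times> 3) \<Rightarrow> complex ^ ('n \<times> 3) ^ ('n \<times> 3) \<Rightarrow> bool" where
  "SW_solution lam x1 x2 x3 z N M \<longleftrightarrow>
    pos_semidef N \<and> pos_semidef M \<and> rank N \<le> 1 \<and>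
    loewner_ge
      (index_matrix (\<lambda>i l j k.
        1 - cnj (Psi (z l) (x1 i) (x2 i) (x3 i)) * Psi (z k) (x1 j) (x2 j) (x3 j)))
      (index_matrix (\<lambda>i l j k. (1 - cnj (z l) * z k) * N $ (i, l) $ (j, k)) +
       index_matrix (\<lambda>i l j k. (1 - cnj (lam i) * lam j) * M $ (i, l) $ (j, k)))"

text \<open>One conjunct per choice: the scalar factorization of \<open>N\<close>, the Gram representation of \<open>M\<close> in a
  Hilbert space \<open>H\<close>, and the contraction on \<open>\<complex>\<^sup>2 \<oplus> H\<close>.\<close>

definition SW_choices ::
    "('n::finite \<Rightarrow> complex) \<Rightarrow> ('n \<Rightarrow> complex) \<Rightarrow> ('n \<Rightarrow> complex) \<Rightarrow> ('n \<Rightarrow> complex) \<Rightarrow> (3 \<Rightarrow> complex)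
      \<Rightarrow> complex ^ ('n \<times> 3) ^ ('n \<times> 3) \<Rightarrow> complex ^ ('n \<times> 3) ^ ('n \<times> 3)
      \<Rightarrow> ('n \<Rightarrow> 3 \<Rightarrow> complex) \<Rightarrow> 'm inner_module \<Rightarrow> ('n \<Rightarrow> 3 \<Rightarrow> 'm)
      \<Rightarrow> complex ^ 2 ^ 2 \<Rightarrow> ('m \<Rightarrow> complex ^ 2) \<Rightarrow> (complex ^ 2 \<Rightarrow> 'm) \<Rightarrow> ('m \<Rightarrow> 'm) \<Rightarrow> bool" where
  "SW_choices lam x1 x2 x3 z N M \<gamma> H v A B C D \<longleftrightarrow>
    (\<forall>i l j k. N $ (i, l) $ (j, k) = cnj (\<gamma> i l) * \<gamma> j k) \<and>
    (hilbert_space H \<and> (\<forall>j k. v j k \<in> carrier H) \<and>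
      (\<forall>i l j k. M $ (i, l) $ (j, k) = ip H (v j k) (v i l))) \<and>
    (contraction_blocks H A B C D \<and>
      (\<forall>j k. block_op H A B C D (vector [1, z k * \<gamma> j k], lam j \<odot>\<^bsub>H\<^esub> v j k) =
        (vector [Psi (z k) (x1 j) (x2 j) (x3 j), \<gamma> j k], v j k)))"

definition SW_function ::
    "'m inner_module \<Rightarrow> complex ^ 2 ^ 2 \<Rightarrow> ('m \<Rightarrow> complex ^ 2) \<Rightarrow> (complex ^ 2 \<Rightarrow> 'm) \<Rightarrow> ('m \<Rightarrow> 'm)
      \<Rightarrow> complex \<Rightarrow> complex \<times> complex \<times> complex" where
  "SW_function H A B C D l =
    (Theta H A B C D l $ 1 $ 1, Theta H A B C D l $ 2 $ 2, det (Theta H A B C D l))"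

end

theory Submission
  imports Defs "HOL-Complex_Analysis.Complex_Analysis"
begin

text \<open>Write \<open>g = x\<^sub>1 x\<^sub>2 - x\<^sub>3\<close>. A point \<open>x\<close> of the closed tetrablock satisfies
  \<open>2 \<bar>g\<bar> \<le> 1 - \<bar>x\<^sub>1\<bar>\<^sup>2 - \<bar>x\<^sub>2\<bar>\<^sup>2 + \<bar>x\<^sub>3\<bar>\<^sup>2\<close>, which says that the matrix with diagonal \<open>x\<^sub>1, x\<^sub>2\<close> and
  off-diagonal entries \<open>f\<^sub>1, f\<^sub>2\<close> is a contraction as soon as \<open>f\<^sub>1 f\<^sub>2 = g\<close> and \<open>\<bar>f\<^sub>1\<bar> = \<bar>f\<^sub>2\<bar>\<close>. On
  the circles \<open>\<bar>\<lambda>\<bar> = r\<close> that avoid the zeros of \<open>g\<close> such a balanced factorization comes from a finite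
  Blaschke product and a square root; the maximum principle carries contractivity into the disc,
  and Montel's theorem lets \<open>r\<close> tend to \<open>1\<close>. So \<open>x = (F\<^sub>1\<^sub>1, F\<^sub>2\<^sub>2, det F)\<close> for a function \<open>F\<close> of the
  Schur class, without inner-outer factorization.

  The function \<open>F\<close> has the coisometric de Branges-Rovnyak realization, in which \<open>D\<close> is the backward
  shift, \<open>B\<close> evaluates at \<open>0\<close> and \<open>C\<close> sends \<open>u\<close> to the difference quotient of \<open>F u\<close>. Then
  \<open>\<gamma>\<^sub>j\<^sub>k = F\<^sub>2\<^sub>1 / (1 - F\<^sub>2\<^sub>2 z\<^sub>k)\<close> at \<open>\<lambda>\<^sub>j\<close> and \<open>v\<^sub>j\<^sub>k = (I - \<lambda>\<^sub>j D)\<^sup>-\<^sup>1 C (1, z\<^sub>k \<gamma>\<^sub>j\<^sub>k)\<close> are the choices in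
  Procedure SW, and the matrix inequality is the contractivity of the colligation.\<close>

no_notation fps_nth (infixl \<open>$\<close> 75)

subsection \<open>Lifting to the Schur class\<close>

text \<open>The matrix with rows \<open>(a, b)\<close> and \<open>(c, d)\<close> is a contraction
  for the Euclidean norm. Scalar entries let results on holomorphic functions be applied entry by
  entry.\<close>

definition contractive2 :: "complex \<Rightarrow> complex \<Rightarrow> complex \<Rightarrow> complex \<Rightarrow> bool" where
  "contractive2 a b c d \<longleftrightarrow>
    (\<forall>u w. (cmod (a * u + b * w))\<^sup>2 + (cmod (c * u + d * w))\<^sup>2 \<le> (cmod u)\<^sup>2 + (cmod w)\<^sup>2)"

section \<open>Modulus inequalities on the closed tetrablock\<close>

lemma closed_tetrablock_flip:
  "(x1, x2, x3) \<in> closed_tetrablock \<Longrightarrow> (x2, x1, x3) \<in> closed_tetrablock"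
  unfolding closed_tetrablock_def by (force simp: algebra_simps)

text \<open>If the inequality failed at a point \<open>w\<close> of the open disc,
  \<open>z = (1 - x2 * w) / (x1 - x3 * w)\<close> would lie in the disc and the defining polynomial
  would vanish at \<open>(z, w)\<close>. Continuity extends the estimate to the circle, where it is
  sharpest.\<close>

lemma closed_tetrablock_le:
  assumes "(x1, x2, x3) \<in> closed_tetrablock" "cmod w \<le> 1"
  shows "cmod (x1 - x3 * w) \<le> cmod (1 - x2 * w)"
proof -
  have "ball 0 1 \<subseteq> {w. cmod (x1 - x3 * w) \<le> cmod (1 - x2 * w)}"
  proof (rule subsetI, rule CollectI, rule ccontr)
    fix w :: complex assume w: "w \<in> ball 0 1"
      and *: "\<not> cmod (x1 - x3 * w) \<le> cmod (1 - x2 * w)"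
    define z where "z = (1 - x2 * w) / (x1 - x3 * w)"
    have nz: "x1 - x3 * w \<noteq> 0" using * by auto
    have "cmod z < 1" using * nz by (auto simp: z_def norm_divide divide_simps)
    then have "1 - x1 * z - x2 * w + x3 * z * w \<noteq> 0"
      using assms(1) w by (auto simp: closed_tetrablock_def)
    moreover have "z * (x1 - x3 * w) = 1 - x2 * w" using nz by (simp add: z_def)
    ultimately show False by (simp add: algebra_simps)
  qed
  moreover have "closed {w. cmod (x1 - x3 * w) \<le> cmod (1 - x2 * w)}"
    by (intro closed_Collect_le continuous_intros)
  ultimately have "closure (ball 0 1) \<subseteq> {w. cmod (x1 - x3 * w) \<le> cmod (1 - x2 * w)}"
    by (rule closure_minimal)
  then show ?thesis using assms(2) by auto
qed

text \<open>This is the previous estimate squared at a unimodular \<open>w\<close> whose phase makes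
  \<open>c * w\<close> equal to \<open>|c|\<close>, so that the terms linear in \<open>w\<close>
  give the most.\<close>

lemma closed_tetrablock_discriminant:
  assumes "(x1, x2, x3) \<in> closed_tetrablock"
  shows "2 * cmod (x2 - cnj x1 * x3) \<le> 1 + (cmod x2)\<^sup>2 - (cmod x1)\<^sup>2 - (cmod x3)\<^sup>2"
proof -
  define c where "c = x2 - cnj x1 * x3"
  define w where "w = (if c = 0 then 1 else cnj c / cmod c)"
  have w1: "cmod w = 1" by (simp add: w_def norm_divide)
  have "c * w = cmod c"
    using complex_norm_square[of c] by (simp add: w_def field_simps power2_eq_square)
  then have cw: "Re (c * w) = cmod c" by simp
  have "(cmod (x1 - x3 * w))\<^sup>2 \<le> (cmod (1 - x2 * w))\<^sup>2"
    using closed_tetrablock_le[OF assms, of w] w1 by (simp add: power_mono)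
  moreover have "(cmod (x1 - x3 * w))\<^sup>2 = (cmod x1)\<^sup>2 + (cmod x3)\<^sup>2 * (cmod w)\<^sup>2 - 2 * Re (cnj x1 * x3 * w)"
    by (simp only: cmod_power2) (simp add: algebra_simps power2_eq_square)
  moreover have "(cmod (1 - x2 * w))\<^sup>2 = 1 + (cmod x2)\<^sup>2 * (cmod w)\<^sup>2 - 2 * Re (x2 * w)"
    by (simp only: cmod_power2) (simp add: algebra_simps power2_eq_square)
  moreover have "Re (c * w) = Re (x2 * w) - Re (cnj x1 * x3 * w)"
    by (simp add: c_def algebra_simps)
  ultimately show ?thesis
    unfolding cw c_def[symmetric] w1 power_one mult_1_right by linarith
qed

text \<open>The bound on \<open>x2\<close> comes from \<open>z = 0\<close> and
  \<open>w = 1 / x2\<close>. The other two together say that the moduli of \<open>x1\<close> and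
  \<open>x3\<close> differ by at most \<open>1 - |x2|\<close>, which is the discriminant estimate
  after a reverse triangle inequality.\<close>

lemma closed_tetrablock_cmod_le:
  assumes "(x1, x2, x3) \<in> closed_tetrablock"
  shows "cmod x2 \<le> 1" "cmod x1 + cmod x2 \<le> 1 + cmod x3" "cmod x2 + cmod x3 \<le> 1 + cmod x1"
proof -
  show 1: "cmod x2 \<le> 1"
  proof (rule ccontr)
    assume "\<not> cmod x2 \<le> 1"
    then have "inverse x2 \<in> ball 0 1" "x2 \<noteq> 0" by (auto simp: norm_inverse inverse_less_1_iff)
    moreover have "1 - x1 * 0 - x2 * w + x3 * 0 * w \<noteq> 0" if "w \<in> ball 0 1" for w
      using assms that unfolding closed_tetrablock_def mem_Collect_eq case_prod_conv
      by (metis centre_in_ball zero_less_one)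
    ultimately show False by force
  qed
  have "cmod x2 - cmod x1 * cmod x3 \<le> cmod (x2 - cnj x1 * x3)"
    using norm_triangle_ineq2[of x2 "cnj x1 * x3"] by (simp add: norm_mult)
  then have "(cmod x1 - cmod x3)\<^sup>2 \<le> (1 - cmod x2)\<^sup>2"
    using closed_tetrablock_discriminant[OF assms] by (simp add: power2_eq_square algebra_simps)
  then have "\<bar>cmod x1 - cmod x3\<bar> \<le> 1 - cmod x2"
    using 1 by (metis abs_le_square_iff abs_of_nonneg diff_ge_0_iff_ge)
  then show "cmod x1 + cmod x2 \<le> 1 + cmod x3" "cmod x2 + cmod x3 \<le> 1 + cmod x1"
    by linarith+
qed

text \<open>A polynomial identity shows that the difference of the squares of the two sides is the
  same here as in \<open>closed_tetrablock_discriminant\<close>. The sign of the right-hand side is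
  then settled by adding the bounds for the squares of \<open>|x1| + |x2|\<close> and
  \<open>|x1| - |x2|\<close>.\<close>

lemma closed_tetrablock_defect:
  assumes "(x1, x2, x3) \<in> closed_tetrablock"
  shows "2 * cmod (x1 * x2 - x3) \<le> 1 - (cmod x1)\<^sup>2 - (cmod x2)\<^sup>2 + (cmod x3)\<^sup>2"
proof -
  let ?a = "cmod x1" and ?b = "cmod x2" and ?c = "cmod x3"
  have "(2 * cmod (x2 - cnj x1 * x3))\<^sup>2 \<le> (1 + ?b\<^sup>2 - ?a\<^sup>2 - ?c\<^sup>2)\<^sup>2"
    by (intro power_mono closed_tetrablock_discriminant assms) auto
  moreover have "(1 + ?b\<^sup>2 - ?a\<^sup>2 - ?c\<^sup>2)\<^sup>2 - (2 * cmod (x2 - cnj x1 * x3))\<^sup>2 =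
    (1 - ?a\<^sup>2 - ?b\<^sup>2 + ?c\<^sup>2)\<^sup>2 - (2 * cmod (x1 * x2 - x3))\<^sup>2"
    unfolding power_mult_distrib
    by (simp only: cmod_power2) (simp add: power2_eq_square algebra_simps)
  ultimately have "(2 * cmod (x1 * x2 - x3))\<^sup>2 \<le> (1 - ?a\<^sup>2 - ?b\<^sup>2 + ?c\<^sup>2)\<^sup>2" by linarith
  moreover have "0 \<le> 1 - ?a\<^sup>2 - ?b\<^sup>2 + ?c\<^sup>2"
  proof -
    have "?a + ?b \<le> 1 + ?c" "\<bar>?a - ?b\<bar> \<le> \<bar>1 - ?c\<bar>"
      using closed_tetrablock_cmod_le[OF assms]
        closed_tetrablock_cmod_le[OF closed_tetrablock_flip[OF assms]] by linarith+
    then have "(?a + ?b)\<^sup>2 \<le> (1 + ?c)\<^sup>2" "(?a - ?b)\<^sup>2 \<le> (1 - ?c)\<^sup>2"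
      by (auto simp: abs_le_square_iff intro: power_mono)
    then show ?thesis by (simp add: power2_eq_square algebra_simps)
  qed
  ultimately show ?thesis
    using power2_le_imp_le by blast
qed

text \<open>With \<open>F\<close> the matrix in question, \<open>p\<close>, \<open>s\<close> and
  \<open>q\<close> are the diagonal and off-diagonal entries of the identity minus the adjoint of
  \<open>F\<close> times \<open>F\<close>; the balance \<open>|f1| = |f2|\<close> enters
  \<open>p\<close>. Positivity follows from trace and determinant. As \<open>det F = x3\<close>,
  nonnegativity of the determinant is exactly the defect inequality.\<close>

lemma contractive2_of_closed_tetrablock:
  assumes "(x1, x2, x3) \<in> closed_tetrablock" "f1 * f2 = x1 * x2 - x3" "cmod f1 = cmod f2"
  shows "contractive2 x1 f1 f2 x2"
proof -
  let ?a = "cmod x1" and ?b = "cmod x2" and ?c = "cmod x3" and ?g = "cmod f1"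
  define p where "p = 1 - ?a\<^sup>2 - ?g\<^sup>2"
  define s where "s = 1 - ?b\<^sup>2 - ?g\<^sup>2"
  define q where "q = - (cnj x1 * f1 + cnj f2 * x2)"
  have g: "cmod (x1 * x2 - x3) = ?g\<^sup>2"
    using assms(2,3) by (metis norm_mult power2_eq_square)
  have def: "2 * ?g\<^sup>2 \<le> 1 - ?a\<^sup>2 - ?b\<^sup>2 + ?c\<^sup>2"
    using closed_tetrablock_defect[OF assms(1)] g by simp
  have x3: "x3 = x1 * x2 - f1 * f2" using assms(2) by simp
  have gg: "(cmod f2)\<^sup>2 = ?g\<^sup>2" using assms(3) by simp
  have det: "p * s - (cmod q)\<^sup>2 = 1 - ?a\<^sup>2 - ?b\<^sup>2 - 2 * ?g\<^sup>2 + ?c\<^sup>2"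
  proof -
    have "(1 - ?a\<^sup>2 - (cmod f2)\<^sup>2) * (1 - ?b\<^sup>2 - ?g\<^sup>2) - (cmod q)\<^sup>2 =
      1 - ?a\<^sup>2 - ?b\<^sup>2 - ?g\<^sup>2 - (cmod f2)\<^sup>2 + ?c\<^sup>2"
      unfolding q_def x3
      by (simp only: cmod_power2) (simp add: power2_eq_square algebra_simps)
    then show ?thesis unfolding p_def s_def gg by simp
  qed
  have ps: "(cmod q)\<^sup>2 \<le> p * s" using det def by linarith
  have c1: "?c \<le> 1"
    using closed_tetrablock_cmod_le(3)[OF assms(1)]
      closed_tetrablock_cmod_le(3)[OF closed_tetrablock_flip[OF assms(1)]] by linarith
  have "p + s \<ge> 0" using def power_le_one[OF _ c1, of 2] by (simp add: p_def s_def)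
  moreover have "p * s \<ge> 0" using ps by (meson order_trans zero_le_power2)
  ultimately have p0: "p \<ge> 0" and s0: "s \<ge> 0"
    by (auto simp: zero_le_mult_iff)
  show ?thesis unfolding contractive2_def
  proof (intro allI)
    fix u w
    have "(cmod u)\<^sup>2 + (cmod w)\<^sup>2 - ((cmod (x1 * u + f1 * w))\<^sup>2 + (cmod (f2 * u + x2 * w))\<^sup>2) =
      (1 - ?a\<^sup>2 - (cmod f2)\<^sup>2) * (cmod u)\<^sup>2 + s * (cmod w)\<^sup>2 + 2 * Re (cnj u * q * w)"
      unfolding s_def q_def
      by (simp only: cmod_power2) (simp add: power2_eq_square algebra_simps)
    moreover have "2 * Re (cnj u * q * w) \<ge> - (p * (cmod u)\<^sup>2 + s * (cmod w)\<^sup>2)"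
    proof -
      have "\<bar>Re (cnj u * q * w)\<bar> \<le> cmod u * cmod q * cmod w"
        using abs_Re_le_cmod[of "cnj u * q * w"] by (simp add: norm_mult)
      also have "\<dots> \<le> cmod u * (sqrt p * sqrt s) * cmod w"
        using ps by (intro mult_mono) (auto simp: real_sqrt_mult[symmetric] real_le_rsqrt p0 s0)
      finally have "2 * \<bar>Re (cnj u * q * w)\<bar> \<le> 2 * (sqrt p * cmod u) * (sqrt s * cmod w)"
        by (simp add: mult_ac)
      also have "\<dots> \<le> (sqrt p * cmod u)\<^sup>2 + (sqrt s * cmod w)\<^sup>2"
        by (rule sum_squares_bound)
      also have "\<dots> = p * (cmod u)\<^sup>2 + s * (cmod w)\<^sup>2"
        using p0 s0 by (simp add: power_mult_distrib)
      finally show ?thesis by linarith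
    qed
    ultimately show "(cmod (x1 * u + f1 * w))\<^sup>2 + (cmod (f2 * u + x2 * w))\<^sup>2 \<le> (cmod u)\<^sup>2 + (cmod w)\<^sup>2"
      unfolding p_def gg by linarith
  qed
qed

section \<open>Factorizations balanced on the unit circle\<close>

lemma analytic_on_cball_nonzero_nbhd:
  assumes "g analytic_on cball 0 1" "\<And>z. z \<in> cball 0 1 \<Longrightarrow> g z \<noteq> (0::complex)"
  obtains R where "R > 1" "g holomorphic_on ball 0 R" "\<And>z. z \<in> ball 0 R \<Longrightarrow> g z \<noteq> 0"
proof -
  obtain T where T: "open T" "cball 0 1 \<subseteq> T" "g holomorphic_on T"
    using assms(1) by (auto simp: analytic_on_holomorphic)
  have "open (T \<inter> g -` (- {0}))"
    using T by (intro continuous_open_preimage holomorphic_on_imp_continuous_on) auto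
  moreover have "cball 0 1 \<subseteq> T \<inter> g -` (- {0})" using T assms(2) by auto
  ultimately obtain e where e: "e > 0" "(\<Union>x\<in>cball 0 1. ball x e) \<subseteq> T \<inter> g -` (- {0})"
    using compact_subset_open_imp_ball_epsilon_subset[OF compact_cball] by metis
  \<comment> \<open>A point outside the closed disc is compared with its radial projection
    \<open>sgn y\<close>.\<close>
  have "ball 0 (1 + e) \<subseteq> (\<Union>x\<in>cball 0 1. ball (x::complex) e)"
  proof
    fix y :: complex assume y: "y \<in> ball 0 (1 + e)"
    show "y \<in> (\<Union>x\<in>cball 0 1. ball x e)"
    proof (cases "cmod y \<le> 1")
      case True then show ?thesis using e(1) by force
    next
      case False
      have "y \<noteq> 0" using False by auto
      then have "y - sgn y = (cmod y - 1) *\<^sub>R sgn y"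
        by (simp add: sgn_div_norm left_diff_distrib scaleR_left_diff_distrib)
      then have "dist (sgn y) y = \<bar>cmod y - 1\<bar> * cmod (sgn y)"
        by (simp add: dist_norm norm_minus_commute)
      then have "y \<in> ball (sgn y) e" "sgn y \<in> cball 0 1"
        using y False by (auto simp: norm_sgn)
      then show ?thesis by blast
    qed
  qed
  then show thesis
    using e T that[of "1 + e"] by (force intro: holomorphic_on_subset)
qed

text \<open>The full order of the zero is removed at once. The quotient is pieced together from the
  local cofactor \<open>k\<close> near \<open>a\<close> and the literal quotient elsewhere; away
  from \<open>a\<close> both satisfy the same equation, so \<open>h\<close> is analytic at every
  point of the closed disc.\<close>

lemma analytic_on_factor_zero:
  assumes g: "g analytic_on cball 0 1" and a: "a \<in> cball 0 1" "g a = 0"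
    and fin: "finite {z \<in> cball 0 1. g z = (0::complex)}"
  obtains h n where "h analytic_on cball 0 1" "h a \<noteq> 0"
    "\<And>z. z \<in> cball 0 1 \<Longrightarrow> g z = (z - a) ^ n * h z"
proof -
  obtain T where T: "open T" "cball 0 1 \<subseteq> T" "g holomorphic_on T"
    using g by (auto simp: analytic_on_holomorphic)
  obtain e where e: "e > 0" "(\<Union>x\<in>cball 0 1. ball x e) \<subseteq> T"
    using compact_subset_open_imp_ball_epsilon_subset[OF compact_cball T(1,2)] by metis
  define S where "S = (\<Union>x\<in>cball 0 1. ball (x::complex) e)"
  have cS: "cball 0 1 \<subseteq> S" using e by (force simp: S_def)
  have S: "open S" "g holomorphic_on S"
    using e T by (auto simp: S_def intro: holomorphic_on_subset)
  \<comment> \<open>The neighbourhood \<open>S\<close> is a Minkowski sum of two balls, hence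
    convex. Connectedness turns nonconstancy on \<open>S\<close> into a zero of finite order at
    \<open>a\<close>.\<close>
  have "connected S"
  proof -
    have "S = {x + y | x y. x \<in> cball 0 1 \<and> y \<in> ball 0 e}"
      unfolding S_def by (force simp: dist_norm image_iff norm_minus_commute)
    then have "S = (\<Union>x\<in>cball 0 1. \<Union>y\<in>ball 0 e. {x + y})" by blast
    then have "convex S" by (simp add: convex_sums)
    then show ?thesis by (rule convex_connected)
  qed
  have nc: "\<not> g constant_on S"
  proof
    assume "g constant_on S"
    then have "g z = 0" if "z \<in> S" for z
      using a cS that by (metis constant_on_def in_mono)
    then have "{z \<in> cball 0 1. g z = (0::complex)} = cball 0 1" using cS by auto
    then have "finite (ball (0::complex) 1)"
      using fin by (metis ball_subset_cball finite_subset)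
    then show False using uncountable_ball[of 1 "0::complex"] countable_finite by force
  qed
  have "a \<in> S" using a(1) cS by blast
  obtain k r n where k: "0 < n" "0 < r" "ball a r \<subseteq> S" "k holomorphic_on ball a r"
    "\<And>w. w \<in> ball a r \<Longrightarrow> g w = (w - a)^n * k w" "\<And>w. w \<in> ball a r \<Longrightarrow> k w \<noteq> 0"
    by (rule holomorphic_factor_zero_nonconstant[OF S(2,1) \<open>connected S\<close> \<open>a \<in> S\<close> a(2) nc])
      (rule that; assumption)
  define h where "h w = (if w \<in> ball a r then k w else g w / (w - a)^n)" for w
  have eq: "g w = (w - a) ^ n * h w" for w
    using k by (cases "w = a") (auto simp: h_def)
  have "h analytic_on {z}" if z: "z \<in> cball 0 1" for z
  proof (cases "z = a")
    case True
    have "k analytic_on {a}" using k by (intro analytic_on_subset[OF analytic_on_open[THEN iffD2]]) auto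
    moreover have "eventually (\<lambda>w. w \<in> ball a r) (nhds a)"
      using k(2) by (intro eventually_nhds_in_open) auto
    then have "eventually (\<lambda>w. h w = k w) (nhds a)" by eventually_elim (auto simp: h_def)
    then have "h analytic_on {a} \<longleftrightarrow> k analytic_on {a}" by (rule analytic_at_cong) simp
    ultimately show ?thesis using True by simp
  next
    case False
    have "(\<lambda>w. g w / (w - a) ^ n) analytic_on {z}"
      using False z by (intro analytic_intros analytic_on_subset[OF g]) auto
    moreover have "eventually (\<lambda>w. w \<in> - {a}) (nhds z)"
      using False by (intro eventually_nhds_in_open) auto
    then have "eventually (\<lambda>w. h w = g w / (w - a) ^ n) (nhds z)"
      by eventually_elim (use eq in \<open>simp add: field_simps\<close>)
    then have "h analytic_on {z} \<longleftrightarrow> (\<lambda>w. g w / (w - a) ^ n) analytic_on {z}"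
      by (rule analytic_at_cong) simp
    ultimately show ?thesis by simp
  qed
  then have "h analytic_on cball 0 1" by (subst analytic_on_analytic_at) blast
  moreover have "h a \<noteq> 0" using k by (simp add: h_def)
  ultimately show thesis using that eq by blast
qed

text \<open>Induction on the number of distinct zeros. Without zeros, \<open>g\<close> has a
  holomorphic square root on a slightly larger disc, which serves as both factors. Otherwise a zero
  \<open>a\<close> is replaced, to its full order, by \<open>1 - cnj a * z\<close>, which has no
  zero in the closed disc; the Blaschke factor lost this way is restored in \<open>f2\<close>
  afterwards.\<close>

lemma balanced_factorization:
  assumes "g analytic_on cball 0 1" "finite {z \<in> cball 0 1. g z = 0}"
    "\<And>z. cmod z = 1 \<Longrightarrow> g z \<noteq> 0"
  obtains f1 f2 where "f1 analytic_on cball 0 1" "f2 analytic_on cball 0 1"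
    "\<And>z. z \<in> cball 0 1 \<Longrightarrow> g z = f1 z * f2 z"
    "\<And>z. cmod z = 1 \<Longrightarrow> cmod (f1 z) = cmod (f2 z)"
proof -
  have "\<exists>f1 f2. f1 analytic_on cball 0 1 \<and> f2 analytic_on cball 0 1 \<and>
      (\<forall>z\<in>cball 0 1. g z = f1 z * f2 z) \<and> (\<forall>z. cmod z = 1 \<longrightarrow> cmod (f1 z) = cmod (f2 z))"
    using assms
  proof (induction "card {z \<in> cball 0 1. g z = 0}" arbitrary: g)
    case 0
    then have nz: "\<And>z. z \<in> cball 0 1 \<Longrightarrow> g z \<noteq> 0" by simp
    obtain R where R: "R > 1" "g holomorphic_on ball 0 R" "\<And>z. z \<in> ball 0 R \<Longrightarrow> g z \<noteq> 0"
      using analytic_on_cball_nonzero_nbhd[OF 0(2) nz] by metis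
    obtain f where f: "f holomorphic_on ball 0 R" "\<And>z. z \<in> ball 0 R \<Longrightarrow> g z = f z ^ 2"
      using contractible_imp_holomorphic_sqrt[OF R(2) convex_imp_contractible[OF convex_ball] R(3)]
      by metis
    have "f analytic_on cball 0 1"
      using f(1) R(1) by (intro analytic_on_subset[OF analytic_on_open[THEN iffD2]]) auto
    moreover have "g z = f z * f z" if "z \<in> cball 0 1" for z
      using f(2) that R(1) by (simp add: power2_eq_square)
    ultimately show ?case by blast
  next
    case (Suc N)
    have "{z \<in> cball 0 1. g z = 0} \<noteq> {}" using Suc.hyps(2) by (metis card.empty nat.distinct(1))
    then obtain a where a: "a \<in> cball 0 1" "g a = 0" by blast
    have a1: "cmod a < 1" using a Suc.prems(3) by (force simp: less_le)
    obtain h n where h: "h analytic_on cball 0 1" "h a \<noteq> 0"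
      "\<And>z. z \<in> cball 0 1 \<Longrightarrow> g z = (z - a) ^ n * h z"
      using analytic_on_factor_zero[OF Suc.prems(1) a Suc.prems(2)] by blast
    have n: "n > 0" using h(2) h(3)[OF a(1)] a(2) by (cases n) auto
    have den: "1 - cnj a * z \<noteq> 0" if "cmod z \<le> 1" for z
    proof -
      have "cmod (cnj a * z) \<le> cmod a * 1"
        unfolding norm_mult complex_mod_cnj using that by (intro mult_left_mono) auto
      then have "cmod (cnj a * z) < 1" using a1 by linarith
      then show ?thesis by force
    qed
    text \<open>Each Blaschke factor has modulus \<open>1\<close> on the circle, so the zeros of \<open>g\<close> can all be put
      into \<open>f2\<close>.\<close>
    define g' where "g' z = h z * (1 - cnj a * z) ^ n" for z
    have zeros: "{z \<in> cball 0 1. g' z = 0} = {z \<in> cball 0 1. g z = 0} - {a}"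
      using h n den by (auto simp: g'_def)
    have "N = card {z \<in> cball 0 1. g' z = 0}"
      using zeros Suc.hyps(2) Suc.prems(2) a by simp
    moreover have "g' analytic_on cball 0 1"
      unfolding g'_def by (intro analytic_intros h)
    moreover have "g' z \<noteq> 0" if "cmod z = 1" for z
      using Suc.prems(3)[OF that] h(3)[of z] that den[of z] by (auto simp: g'_def)
    ultimately obtain f1 f2 where f: "f1 analytic_on cball 0 1" "f2 analytic_on cball 0 1"
      "\<And>z. z \<in> cball 0 1 \<Longrightarrow> g' z = f1 z * f2 z" "\<And>z. cmod z = 1 \<Longrightarrow> cmod (f1 z) = cmod (f2 z)"
      using Suc.hyps(1)[of g'] zeros Suc.prems(2) by auto
    define b where "b z = ((z - a) / (1 - cnj a * z)) ^ n" for z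
    have "(\<lambda>z. f2 z * b z) analytic_on cball 0 1"
      unfolding b_def using den by (intro analytic_intros f) auto
    moreover have "g z = f1 z * (f2 z * b z)" if z: "z \<in> cball 0 1" for z
    proof -
      have "f1 z * (f2 z * b z) = g' z * b z" using f(3)[OF z] by simp
      also have "\<dots> = g z" using h(3)[OF z] den[of z] z by (simp add: g'_def b_def power_divide)
      finally show ?thesis by simp
    qed
    moreover have "cmod (f1 z) = cmod (f2 z * b z)" if z: "cmod z = 1" for z
    proof -
      have "cmod (1 - cnj a * z) = cmod (cnj z * (1 - cnj a * z))" using z by (simp add: norm_mult)
      also have "cnj z * (1 - cnj a * z) = cnj (z - a)"
        using complex_norm_square[of z] z by (simp add: algebra_simps)
      finally have "cmod (1 - cnj a * z) = cmod (z - a)" by (simp only: complex_mod_cnj)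
      then have "cmod (b z) = 1"
        using den[of z] z by (auto simp: b_def norm_power norm_divide)
      then show ?thesis using f(4)[OF z] by (simp add: norm_mult)
    qed
    ultimately show ?case using f(1) by blast
  qed
  then show thesis using that by blast
qed

section \<open>Contractivity under the maximum principle and under limits\<close>

lemma mult_add_le_sqrt:
  "a * c + b * d \<le> sqrt (a\<^sup>2 + b\<^sup>2) * sqrt (c\<^sup>2 + d\<^sup>2)" for a b c d :: real
proof -
  have "(a\<^sup>2 + b\<^sup>2) * (c\<^sup>2 + d\<^sup>2) - (a * c + b * d)\<^sup>2 = (a * d - b * c)\<^sup>2"
    by (simp add: power2_eq_square algebra_simps)
  then have "(a * c + b * d)\<^sup>2 \<le> (a\<^sup>2 + b\<^sup>2) * (c\<^sup>2 + d\<^sup>2)"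
    by (smt (verit) zero_le_power2)
  then show ?thesis
    unfolding real_sqrt_mult[symmetric] by (rule real_le_rsqrt)
qed

text \<open>Pairing the image of \<open>(u, w)\<close> at \<open>z\<close> with the fixed image
  \<open>(p, q)\<close> at \<open>z0\<close> reduces the claim to a scalar holomorphic function. On
  the circle it is at most \<open>sqrt s * sqrt t\<close>, while at \<open>z0\<close> it equals
  \<open>s\<close>, whence \<open>s \<le> t\<close>.\<close>

lemma contractive2_maximum_principle:
  assumes hol: "a analytic_on cball 0 1" "b analytic_on cball 0 1"
      "c analytic_on cball 0 1" "d analytic_on cball 0 1"
    and bd: "\<And>z. cmod z = 1 \<Longrightarrow> contractive2 (a z) (b z) (c z) (d z)"
    and z0: "z0 \<in> cball 0 1"
  shows "contractive2 (a z0) (b z0) (c z0) (d z0)"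
  unfolding contractive2_def
proof (intro allI)
  fix u w
  define p where "p = a z0 * u + b z0 * w"
  define q where "q = c z0 * u + d z0 * w"
  define s where "s = (cmod p)\<^sup>2 + (cmod q)\<^sup>2"
  define t where "t = (cmod u)\<^sup>2 + (cmod w)\<^sup>2"
  define \<phi> where "\<phi> z = cnj p * (a z * u + b z * w) + cnj q * (c z * u + d z * w)" for z
  have an: "\<phi> analytic_on cball 0 1"
    unfolding \<phi>_def by (intro analytic_intros hol)
  then have hol\<phi>: "\<phi> holomorphic_on cball 0 1" by (rule analytic_imp_holomorphic)
  have "cmod (\<phi> z0) \<le> sqrt s * sqrt t"
  proof (rule maximum_modulus_frontier[of \<phi> "cball 0 1"])
    show "\<phi> holomorphic_on interior (cball 0 1)"
      using hol\<phi> by (rule holomorphic_on_subset) (rule interior_subset)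
    show "continuous_on (closure (cball 0 1)) \<phi>"
      using holomorphic_on_imp_continuous_on[OF hol\<phi>] by simp
    fix z :: complex assume "z \<in> frontier (cball 0 1)"
    then have z: "cmod z = 1" by simp
    let ?x = "a z * u + b z * w" and ?y = "c z * u + d z * w"
    have "cmod (\<phi> z) \<le> cmod p * cmod ?x + cmod q * cmod ?y"
      unfolding \<phi>_def by (metis (no_types, lifting) complex_mod_cnj norm_mult norm_triangle_ineq)
    also have "\<dots> \<le> sqrt s * sqrt ((cmod ?x)\<^sup>2 + (cmod ?y)\<^sup>2)"
      unfolding s_def by (rule mult_add_le_sqrt)
    also have "\<dots> \<le> sqrt s * sqrt t"
      using bd[OF z] by (intro mult_left_mono) (auto simp: contractive2_def t_def s_def)
    finally show "cmod (\<phi> z) \<le> sqrt s * sqrt t" .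
  qed (use z0 in auto)
  moreover have "\<phi> z0 = cnj p * p + cnj q * q" by (simp add: \<phi>_def p_def q_def)
  then have "\<phi> z0 = of_real s"
    unfolding s_def of_real_add complex_norm_square by (simp add: mult.commute)
  moreover have "s \<ge> 0" by (simp add: s_def)
  ultimately have "sqrt s * sqrt s \<le> sqrt s * sqrt t"
    by (simp only: norm_of_real abs_of_nonneg real_sqrt_mult_self)
  then have "s = 0 \<or> sqrt s \<le> sqrt t"
    using \<open>s \<ge> 0\<close> mult_le_cancel_left_pos[of "sqrt s" "sqrt s" "sqrt t"] by fastforce
  then have "s \<le> t"
    by (auto simp: t_def)
  then show "(cmod (a z0 * u + b z0 * w))\<^sup>2 + (cmod (c z0 * u + d z0 * w))\<^sup>2 \<le> (cmod u)\<^sup>2 + (cmod w)\<^sup>2"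
    by (simp add: s_def t_def p_def q_def)
qed

lemma contractive2_norm_le:
  assumes "contractive2 a b c d"
  shows "cmod a \<le> 1" "cmod b \<le> 1" "cmod c \<le> 1" "cmod d \<le> 1"
proof -
  have 1: "(cmod a)\<^sup>2 + (cmod c)\<^sup>2 \<le> 1" using assms[unfolded contractive2_def, rule_format, of 1 0] by simp
  have 2: "(cmod b)\<^sup>2 + (cmod d)\<^sup>2 \<le> 1" using assms[unfolded contractive2_def, rule_format, of 0 1] by simp
  have "(cmod a)\<^sup>2 \<le> 1" "(cmod b)\<^sup>2 \<le> 1" "(cmod c)\<^sup>2 \<le> 1" "(cmod d)\<^sup>2 \<le> 1"
    using 1 2 zero_le_power2[of "cmod a"] zero_le_power2[of "cmod b"]
      zero_le_power2[of "cmod c"] zero_le_power2[of "cmod d"] by linarith+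
  then show "cmod a \<le> 1" "cmod b \<le> 1" "cmod c \<le> 1" "cmod d \<le> 1"
    by (auto simp: abs_square_le_1)
qed

lemma contractive2_LIMSEQ:
  assumes "A \<longlonglongrightarrow> a" "B \<longlonglongrightarrow> b" "C \<longlonglongrightarrow> c" "D \<longlonglongrightarrow> d"
    "\<And>n. contractive2 (A n) (B n) (C n) (D n)"
  shows "contractive2 a b c d"
  unfolding contractive2_def
proof (intro allI)
  fix u w
  show "(cmod (a * u + b * w))\<^sup>2 + (cmod (c * u + d * w))\<^sup>2 \<le> (cmod u)\<^sup>2 + (cmod w)\<^sup>2"
  proof (rule LIMSEQ_le_const2)
    show "(\<lambda>n. (cmod (A n * u + B n * w))\<^sup>2 + (cmod (C n * u + D n * w))\<^sup>2) \<longlonglongrightarrow>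
      (cmod (a * u + b * w))\<^sup>2 + (cmod (c * u + d * w))\<^sup>2"
      by (intro tendsto_intros assms)
  qed (use assms(5) in \<open>auto simp: contractive2_def\<close>)
qed

lemma schur_lift_of_tetrablock:
  assumes hol: "x1 holomorphic_on ball 0 1" "x2 holomorphic_on ball 0 1" "x3 holomorphic_on ball 0 1"
    and tet: "\<And>l. l \<in> ball 0 1 \<Longrightarrow> (x1 l, x2 l, x3 l) \<in> closed_tetrablock"
    and ne: "l0 \<in> ball 0 1" "x1 l0 * x2 l0 \<noteq> x3 l0"
  obtains f1 f2 where "f1 holomorphic_on ball 0 1" "f2 holomorphic_on ball 0 1"
    "\<And>l. l \<in> ball 0 1 \<Longrightarrow> contractive2 (x1 l) (f1 l) (f2 l) (x2 l)"
    "\<And>l. l \<in> ball 0 1 \<Longrightarrow> x1 l * x2 l - f1 l * f2 l = x3 l"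
proof -
  define g where "g l = x1 l * x2 l - x3 l" for l
  have g: "g holomorphic_on ball 0 1" unfolding g_def by (intro holomorphic_intros hol)
  let ?Z = "{z \<in> ball 0 1. g z = 0}"
  \<comment> \<open>Zeros of \<open>g\<close> may accumulate at the boundary, so countability is the
    most that holds on the open disc; it follows by exhausting the disc with compact sets.\<close>
  have "fsigma (ball (0::complex) 1)"
    unfolding fsigma_Union_compact using open_Union_compact_subsets[OF open_ball[of "0::complex" 1]]
    by (metis image_subsetI mem_Collect_eq)
  then have Z: "countable ?Z" if "\<not> g constant_on ball 0 1"
    using that by (intro holomorphic_countable_zeros g) auto
  have Z: "countable ?Z"
  \<comment> \<open>The node \<open>l0\<close> excludes the function that is identically
    zero.\<close>
  proof (cases "g constant_on ball 0 1")
    case True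
    then have "g z = g l0" if "z \<in> ball 0 1" for z using ne(1) that by (metis constant_on_def)
    moreover have "g l0 \<noteq> 0" using ne(2) by (simp add: g_def)
    ultimately have "?Z = {}" by auto
    then show ?thesis by (metis countable_empty)
  qed (rule Z)
  have step: "\<exists>r F G. 1 - 1 / Suc n < r \<and> r < 1 \<and>
      F holomorphic_on ball 0 1 \<and> G holomorphic_on ball 0 1 \<and>
      (\<forall>z\<in>ball 0 1. contractive2 (x1 (of_real r * z)) (F z) (G z) (x2 (of_real r * z)) \<and>
        g (of_real r * z) = F z * G z)" for n
  proof -
    \<comment> \<open>The moduli of the zeros form a countable set, so radii arbitrarily close to
      \<open>1\<close> miss all of them.\<close>
    have "uncountable {1 - 1 / Suc n <..< 1}" by (simp add: uncountable_open_interval)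
    moreover have "countable (cmod ` ?Z)" using Z by (rule countable_image)
    ultimately have "\<not> {1 - 1 / Suc n <..< 1} \<subseteq> cmod ` ?Z" using countable_subset by blast
    then obtain r where r: "r \<in> {1 - 1 / Suc n <..< 1}" "r \<notin> cmod ` ?Z" by blast
    have r01: "0 < r" "r < 1"
      using r(1) by (auto intro: le_less_trans[of 0 "1 - 1 / Suc n"])
    have maps: "(\<lambda>z. of_real r * z) ` ball 0 (1 / r) \<subseteq> ball (0::complex) 1"
      using r01 by (auto simp: norm_mult field_simps)
    have sub: "cball 0 1 \<subseteq> ball (0::complex) (1 / r)"
    proof -
      have "1 < 1 / r" using r01 by simp
      then show ?thesis by auto
    qed
    have an: "(\<lambda>z. f (of_real r * z)) analytic_on cball 0 1" if "f holomorphic_on ball 0 1" for f :: "complex \<Rightarrow> complex"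
    proof -
      have "(f \<circ> (\<lambda>z. of_real r * z)) holomorphic_on ball 0 (1 / r)"
        by (rule holomorphic_on_compose_gen[OF _ that maps]) (intro holomorphic_intros)
      then show ?thesis
        using sub by (auto simp: analytic_on_holomorphic o_def)
    qed
    let ?g = "\<lambda>z. g (of_real r * z)"
    have gnz: "?g z \<noteq> 0" if "cmod z = 1" for z
    proof
      assume "?g z = 0"
      then have "of_real r * z \<in> ?Z" using that r01 by (simp add: norm_mult)
      moreover have "cmod (of_real r * z) = r" using that r01 by (simp add: norm_mult)
      ultimately show False using r(2) by (metis imageI)
    qed
    have "finite {z \<in> cball 0 1. ?g z = 0}"
    proof (cases "?g constant_on ball 0 (1 / r)")
      case True
      then have "?g z = ?g 1" if "z \<in> cball 0 1" for z
        using sub that unfolding constant_on_def by (metis in_mono mem_cball_0 norm_one order_refl)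
      then have "{z \<in> cball 0 1. ?g z = 0} = {}" using gnz[of 1] by auto
      then show ?thesis by (metis finite.emptyI)
    next
      case False
      have "(g \<circ> (\<lambda>z. of_real r * z)) holomorphic_on ball 0 (1 / r)"
        by (rule holomorphic_on_compose_gen[OF _ g maps]) (intro holomorphic_intros)
      then have "?g holomorphic_on ball 0 (1 / r)" by (simp add: o_def)
      then show ?thesis
        using sub False by (rule_tac holomorphic_compact_finite_zeros) auto
    qed
    then obtain F G where FG: "F analytic_on cball 0 1" "G analytic_on cball 0 1"
      "\<And>z. z \<in> cball 0 1 \<Longrightarrow> ?g z = F z * G z" "\<And>z. cmod z = 1 \<Longrightarrow> cmod (F z) = cmod (G z)"
      using balanced_factorization[OF an[OF g] _ gnz] by blast
    have "contractive2 (x1 (of_real r * z)) (F z) (G z) (x2 (of_real r * z))" if z: "z \<in> cball 0 1" for z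
    proof (rule contractive2_maximum_principle[OF an[OF hol(1)] FG(1,2) an[OF hol(2)] _ z])
      fix z :: complex assume z: "cmod z = 1"
      have "of_real r * z \<in> ball 0 1" using z r01 by (simp add: norm_mult)
      then show "contractive2 (x1 (of_real r * z)) (F z) (G z) (x2 (of_real r * z))"
        using FG(3)[of z] FG(4)[OF z] z
        by (intro contractive2_of_closed_tetrablock[OF tet]) (auto simp: g_def)
    qed
    moreover have "F holomorphic_on ball 0 1" "G holomorphic_on ball 0 1"
      using FG(1,2) by (meson analytic_imp_holomorphic ball_subset_cball holomorphic_on_subset)+
    ultimately show ?thesis using r FG(3) by (intro exI[of _ r] exI[of _ F] exI[of _ G]) auto
  qed
  obtain r F G where rFG: "\<And>n. 1 - 1 / Suc n < r n" "\<And>n. r n < 1"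
      "\<And>n. F n holomorphic_on ball 0 1" "\<And>n. G n holomorphic_on ball 0 1"
      "\<And>n z. z \<in> ball 0 1 \<Longrightarrow> contractive2 (x1 (of_real (r n) * z)) (F n z) (G n z) (x2 (of_real (r n) * z))"
      "\<And>n z. z \<in> ball 0 1 \<Longrightarrow> g (of_real (r n) * z) = F n z * G n z"
    using step by metis
  have r0: "r n > 0" for n
    using rFG(1)[of n] by (auto intro: le_less_trans[of 0 "1 - 1 / Suc n"])
  have "r \<longlonglongrightarrow> 1"
  proof (rule tendsto_sandwich)
    show "(\<lambda>n. 1 - 1 / Suc n) \<longlonglongrightarrow> 1" using LIMSEQ_inverse_real_of_nat_add_minus[of 1] by (simp add: field_simps)
  qed (use rFG in \<open>auto intro!: always_eventually less_imp_le\<close>)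
  let ?H = "{h. h holomorphic_on ball 0 1 \<and> (\<forall>z\<in>ball 0 1. cmod (h z) \<le> 1)}"
  have Mont: "\<exists>f \<rho>. f holomorphic_on ball 0 1 \<and> strict_mono (\<rho> :: nat \<Rightarrow> nat) \<and>
      (\<forall>z\<in>ball 0 1. (\<lambda>n. K (\<rho> n) z) \<longlonglongrightarrow> f z)" if K: "range K \<subseteq> ?H" for K
  proof (rule Montel[OF open_ball[of 0 1] _ _ K])
    show "\<exists>B. \<forall>h\<in>?H. \<forall>z\<in>C. cmod (h z) \<le> B" if "C \<subseteq> ball 0 1" for C
      using that by (intro exI[of _ 1]) auto
  qed blast+
  have "range F \<subseteq> ?H"
    using rFG(3) contractive2_norm_le(2)[OF rFG(5)] by auto
  then obtain f1 \<rho> where f1: "f1 holomorphic_on ball 0 1" "strict_mono \<rho>"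
    "\<And>z. z \<in> ball 0 1 \<Longrightarrow> (\<lambda>n. F (\<rho> n) z) \<longlonglongrightarrow> f1 z"
    using Mont[OF \<open>range F \<subseteq> ?H\<close>] by metis
  \<comment> \<open>The second Montel extraction runs inside the first subsequence, so that both
    factors converge along the same indices.\<close>
  define G' where "G' n = G (\<rho> n)" for n
  have "range G' \<subseteq> ?H"
    using rFG(4) contractive2_norm_le(3)[OF rFG(5)] by (auto simp: G'_def)
  then obtain f2 \<sigma> where f2: "f2 holomorphic_on ball 0 1" "strict_mono \<sigma>"
    "\<And>z. z \<in> ball 0 1 \<Longrightarrow> (\<lambda>n. G' (\<sigma> n) z) \<longlonglongrightarrow> f2 z"
    using Mont[OF \<open>range G' \<subseteq> ?H\<close>] by metis
  have f1': "(\<lambda>n. F (\<rho> (\<sigma> n)) z) \<longlonglongrightarrow> f1 z" if "z \<in> ball 0 1" for z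
    using LIMSEQ_subseq_LIMSEQ[OF f1(3)[OF that] f2(2)] by (simp add: o_def)
  have f2': "(\<lambda>n. G (\<rho> (\<sigma> n)) z) \<longlonglongrightarrow> f2 z" if "z \<in> ball 0 1" for z
    using f2(3)[OF that] by (simp add: G'_def)
  have lim: "(\<lambda>n. h (of_real (r (\<rho> (\<sigma> n))) * z)) \<longlonglongrightarrow> h z"
    if "h holomorphic_on ball 0 1" "z \<in> ball 0 1" for h :: "complex \<Rightarrow> complex" and z
  proof -
    have "(\<lambda>n. r (\<rho> (\<sigma> n))) \<longlonglongrightarrow> 1"
      using LIMSEQ_subseq_LIMSEQ[OF \<open>r \<longlonglongrightarrow> 1\<close> strict_mono_o[OF f1(2) f2(2)]] by (simp add: o_def)
    then have "(\<lambda>n. of_real (r (\<rho> (\<sigma> n))) * z) \<longlonglongrightarrow> of_real 1 * z"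
      by (intro tendsto_intros)
    moreover have "isCont h z"
      using that holomorphic_on_imp_continuous_on continuous_on_eq_continuous_at open_ball by blast
    ultimately show ?thesis by (auto intro: isCont_tendsto_compose[of z h])
  qed
  show thesis
  proof
    fix l :: complex assume l: "l \<in> ball 0 1"
    show "contractive2 (x1 l) (f1 l) (f2 l) (x2 l)"
      by (rule contractive2_LIMSEQ[OF lim[OF hol(1) l] f1'[OF l] f2'[OF l] lim[OF hol(2) l] rFG(5)[OF l]])
    have "(\<lambda>n. F (\<rho> (\<sigma> n)) l * G (\<rho> (\<sigma> n)) l) \<longlonglongrightarrow> f1 l * f2 l"
      by (intro tendsto_mult f1' f2' l)
    then have "(\<lambda>n. g (of_real (r (\<rho> (\<sigma> n))) * l)) \<longlonglongrightarrow> f1 l * f2 l"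
      by (simp add: rFG(6)[OF l])
    then have "g l = f1 l * f2 l" using lim[OF g l] LIMSEQ_unique by blast
    then show "x1 l * x2 l - f1 l * f2 l = x3 l" by (simp add: g_def algebra_simps)
  qed (use f1 f2 in auto)
qed

subsection \<open>A Hilbert space of sequences from a semi-inner product on polynomials\<close>

text \<open>Polynomials stand for finitely supported vectors, so an arbitrary sequence acts on them
  as a conjugate-linear functional and no convergence question arises.\<close>

definition pairing :: "(nat \<Rightarrow> complex) \<Rightarrow> complex poly \<Rightarrow> complex" where
  "pairing f q = (\<Sum>i\<le>degree q. f i * cnj (coeff q i))"

lemma pairing_eq: "degree q \<le> N \<Longrightarrow> pairing f q = (\<Sum>i\<le>N. f i * cnj (coeff q i))"
  unfolding pairing_def by (rule sum.mono_neutral_left) (auto simp: coeff_eq_0)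

lemma pairing_add_left: "pairing (\<lambda>i. f i + g i) q = pairing f q + pairing g q"
  by (simp add: pairing_def sum.distrib algebra_simps)

lemma pairing_mult_left: "pairing (\<lambda>i. c * f i) q = c * pairing f q"
  by (simp add: pairing_def sum_distrib_left algebra_simps)

lemma pairing_add_right: "pairing f (p + q) = pairing f p + pairing f q"
proof -
  define N where "N = max (degree p) (degree q)"
  have "degree p \<le> N" "degree q \<le> N" "degree (p + q) \<le> N"
    by (auto simp: N_def degree_add_le_max)
  then show ?thesis by (simp add: pairing_eq[of _ N] sum.distrib algebra_simps)
qed

lemma pairing_smult_right: "pairing f (Polynomial.smult c q) = cnj c * pairing f q"
  by (simp add: pairing_eq[of _ "degree q"] degree_smult_le sum_distrib_left algebra_simps)

lemma pairing_0_right [simp]: "pairing f 0 = 0"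
  by (simp add: pairing_def)

lemma pairing_sum_right: "pairing f (\<Sum>k\<in>S. p k) = (\<Sum>k\<in>S. pairing f (p k))"
  by (induction S rule: infinite_finite_induct) (auto simp: pairing_add_right)

lemma pairing_monom: "pairing f (monom 1 i) = f i"
proof -
  have "pairing f (monom 1 i) = (\<Sum>k\<le>i. f k * cnj (coeff (monom 1 i) k))"
    by (simp add: pairing_def degree_monom_eq)
  also have "\<dots> = (\<Sum>k\<le>i. if k = i then f k else 0)"
    by (rule sum.cong) auto
  finally have "pairing f (monom 1 i) = (\<Sum>k\<le>i. if k = i then f k else 0)" .
  then show ?thesis by simp
qed

lemma pairing_pCons: "pairing f (pCons w q) = f 0 * cnj w + pairing (\<lambda>i. f (Suc i)) q"
  by (subst pairing_eq[OF degree_pCons_le]) (simp add: pairing_def sum.atMost_Suc_shift del: sum.atMost_Suc)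

lemma pairing_cnj: "pairing (coeff q) p = cnj (pairing (coeff p) q)"
proof -
  define N where "N = max (degree p) (degree q)"
  have "degree p \<le> N" "degree q \<le> N" by (auto simp: N_def)
  then show ?thesis by (simp add: pairing_eq[of _ N] mult.commute)
qed

lemma pairing_LIMSEQ:
  assumes "\<And>i. (\<lambda>n. f n i) \<longlonglongrightarrow> g i"
  shows "(\<lambda>n. pairing (f n) q) \<longlonglongrightarrow> pairing g q"
  unfolding pairing_def by (intro tendsto_intros assms)

section \<open>Gram-Schmidt for a semi-inner product\<close>

locale semi_inner =
  fixes s :: "complex poly \<Rightarrow> complex poly \<Rightarrow> complex"
  assumes add_left: "s (p + p') q = s p q + s p' q"
    and smult_left: "s (Polynomial.smult c p) q = c * s p q"
    and cnj_sym: "s q p = cnj (s p q)"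
    and nonneg: "Re (s p p) \<ge> 0"
begin

lemma add_right: "s p (q + q') = s p q + s p q'"
  by (metis add_left cnj_sym complex_cnj_add)

lemma smult_right: "s p (Polynomial.smult c q) = cnj c * s p q"
  by (metis smult_left cnj_sym complex_cnj_mult)

lemma diff_left: "s (p - p') q = s p q - s p' q"
  using add_left[of "p - p'" p' q] by simp

lemma diff_right: "s p (q - q') = s p q - s p q'"
  using add_right[of p "q - q'" q'] by simp

lemma zero_left [simp]: "s 0 q = 0"
  using smult_left[of 0 0 q] by simp

lemma zero_right [simp]: "s q 0 = 0"
  using smult_right[of q 0 0] by simp

lemma sum_left: "s (\<Sum>k\<in>S. p k) q = (\<Sum>k\<in>S. s (p k) q)"
  by (induction S rule: infinite_finite_induct) (auto simp: add_left)

definition Q :: "complex poly \<Rightarrow> real" where "Q p = Re (s p p)"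

lemma s_self: "s p p = of_real (Q p)"
  by (metis Q_def cnj_sym Reals_cnj_iff of_real_Re)

lemma Q_nonneg: "Q p \<ge> 0" by (simp add: Q_def nonneg)

text \<open>The Cauchy-Schwarz argument in the degenerate case: if \<open>s p q\<close> were
  nonzero, subtracting a multiple of \<open>p\<close> from \<open>q\<close> would lower
  \<open>Q q\<close> without bound. The value of \<open>t\<close> makes the result
  \<open>- Q q - 2\<close>.\<close>

lemma null:
  assumes "Q p = 0"
  shows "s p q = 0"
proof (rule ccontr)
  assume ne: "s p q \<noteq> 0"
  define c where "c = s p q"
  define t where "t = (Q q + 1) / (cmod c)\<^sup>2"
  have cn: "cmod c \<noteq> 0" using ne by (simp add: c_def)
  have cc: "c * cnj c = of_real ((cmod c)\<^sup>2)" using complex_norm_square[of c] by simp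
  have "s (q - Polynomial.smult (of_real t * cnj c) p) (q - Polynomial.smult (of_real t * cnj c) p)
      = of_real (Q q) - of_real (2 * t) * (c * cnj c)"
    using s_self[of p] s_self[of q] cnj_sym[of q p] assms
    by (simp add: diff_left diff_right smult_left smult_right c_def algebra_simps)
  then have "Q (q - Polynomial.smult (of_real t * cnj c) p) = Q q - 2 * t * (cmod c)\<^sup>2"
    unfolding cc Q_def[of "q - _"] by simp
  also have "\<dots> = - Q q - 2" using cn by (simp add: t_def field_simps)
  finally show False using Q_nonneg[of q] Q_nonneg[of "q - Polynomial.smult (of_real t * cnj c) p"] by linarith
qed

text \<open>Gram-Schmidt on the monomials for a possibly degenerate form: a null residual is divided by
  \<open>sqrt 0\<close>, so its normalization is \<open>0\<close>.\<close>

definition unit_vec :: "complex poly \<Rightarrow> complex poly" where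
  "unit_vec r = Polynomial.smult (of_real (1 / sqrt (Q r))) r"

text \<open>What is left of \<open>q\<close> after projecting away the first \<open>n\<close> basis
  vectors. The basis is itself built from residuals, so its definition is inlined in the recursion
  and folded back in \<open>residual_Suc\<close>.\<close>

primrec residual :: "nat \<Rightarrow> complex poly \<Rightarrow> complex poly" where
  "residual 0 q = q"
| "residual (Suc n) q = residual n q -
    Polynomial.smult (s (residual n q) (unit_vec (residual n (monom 1 n)))) (unit_vec (residual n (monom 1 n)))"

definition basis :: "nat \<Rightarrow> complex poly" where
  "basis n = unit_vec (residual n (monom 1 n))"

lemma residual_Suc: "residual (Suc n) q = residual n q - Polynomial.smult (s (residual n q) (basis n)) (basis n)"
  by (simp add: basis_def)

declare residual.simps(2) [simp del]

lemma residual_add: "residual n (p + q) = residual n p + residual n q"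
  by (induction n) (auto simp: residual_Suc add_left smult_add_left algebra_simps)

lemma residual_smult: "residual n (Polynomial.smult c q) = Polynomial.smult c (residual n q)"
  by (induction n) (auto simp: residual_Suc smult_left smult_diff_right)

lemma basis_cases: "basis n = 0 \<or> s (basis n) (basis n) = 1"
proof (cases "Q (residual n (monom 1 n)) = 0")
  case True then show ?thesis by (simp add: basis_def unit_vec_def)
next
  case False
  let ?r = "residual n (monom 1 n)"
  have "Q ?r > 0" using False Q_nonneg[of ?r] by linarith
  then have "complex_of_real (sqrt (Q ?r)) * of_real (sqrt (Q ?r)) = of_real (Q ?r)"
    by (simp flip: of_real_mult)
  then show ?thesis using \<open>Q ?r > 0\<close>
    by (simp add: basis_def unit_vec_def smult_left smult_right s_self[of ?r] field_simps)
qed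

lemma residual_orthogonal: "k < n \<Longrightarrow> s (residual n q) (basis k) = 0"
proof (induction n arbitrary: q)
  case (Suc n)
  show ?case
  proof (cases "k = n")
    case True
    then show ?thesis using basis_cases[of n] by (auto simp: residual_Suc diff_left smult_left)
  next
    case False
    then have "k < n" using Suc.prems by simp
    have "s (basis n) (basis k) = 0"
      unfolding basis_def[of n] unit_vec_def by (simp add: smult_left Suc.IH[OF \<open>k < n\<close>])
    then show ?thesis by (simp add: residual_Suc diff_left smult_left Suc.IH[OF \<open>k < n\<close>])
  qed
qed simp

lemma basis_orthogonal: "k \<noteq> n \<Longrightarrow> s (basis n) (basis k) = 0"
proof (induction k n rule: linorder_wlog)
  case (le k n)
  then show ?case
    by (simp add: basis_def[of n] unit_vec_def smult_left residual_orthogonal)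
next
  case (sym k n)
  then show ?case by (metis cnj_sym complex_cnj_zero)
qed

lemma basis_expansion: "q = residual n q + (\<Sum>k<n. Polynomial.smult (s q (basis k)) (basis k))"
proof (induction n)
  case (Suc n)
  have "s q (basis n) = s (residual n q) (basis n) + (\<Sum>k<n. s q (basis k) * s (basis k) (basis n))"
    by (subst Suc.IH) (simp add: add_left sum_left smult_left)
  also have "(\<Sum>k<n. s q (basis k) * s (basis k) (basis n)) = 0"
    by (intro sum.neutral) (auto simp: basis_orthogonal)
  finally have "s q (basis n) = s (residual n q) (basis n)" by simp
  then show ?case using Suc.IH by (simp add: residual_Suc)
qed simp

text \<open>The first \<open>n\<close> basis vectors span the polynomials of degree below
  \<open>n\<close> modulo null vectors. In the induction the top monomial is split off: the rest is
  null already after \<open>n\<close> steps, and the monomial becomes null in the next one.\<close>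

lemma Q_residual_eq_0:
  assumes "\<And>i. i \<ge> n \<Longrightarrow> coeff q i = 0"
  shows "Q (residual n q) = 0"
  using assms
proof (induction n arbitrary: q)
  case 0
  then have "q = 0" by (intro poly_eqI) auto
  then show ?case by (simp add: Q_def)
next
  case (Suc n)
  define q' where "q' = q - monom (coeff q n) n"
  have q: "q = q' + Polynomial.smult (coeff q n) (monom 1 n)" by (simp add: q'_def smult_monom)
  have "coeff q' i = 0" if "i \<ge> n" for i
    using that Suc.prems[of i] by (cases "i = n") (auto simp: q'_def)
  then have "Q (residual n q') = 0" by (rule Suc.IH)
  then have n1: "s (residual n q') p = 0" for p by (rule null)
  then have R1: "residual (Suc n) q' = residual n q'" by (simp add: residual_Suc)
  let ?r = "residual n (monom 1 n)"
  \<comment> \<open>Either the residual of the monomial is already null, or it is a multiple of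
    \<open>basis n\<close> and the next projection removes it exactly.\<close>
  have n2: "s (residual (Suc n) (monom 1 n)) p = 0" for p
  proof (cases "Q ?r = 0")
    case True
    then show ?thesis by (simp add: residual_Suc diff_left smult_left null)
  next
    case False
    then have "Q ?r > 0" using Q_nonneg[of ?r] by linarith
    then have "complex_of_real (sqrt (Q ?r)) * of_real (sqrt (Q ?r)) = of_real (Q ?r)"
      by (simp flip: of_real_mult)
    then have "s ?r (basis n) * of_real (1 / sqrt (Q ?r)) = 1"
      using \<open>Q ?r > 0\<close> by (simp add: basis_def unit_vec_def smult_right s_self field_simps)
    then have "Polynomial.smult (s ?r (basis n)) (basis n) = ?r"
      by (subst (2) basis_def) (simp add: unit_vec_def)
    then show ?thesis by (simp add: residual_Suc)
  qed
  have "s (residual (Suc n) q) p = 0" for p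
    by (subst q) (simp add: residual_add residual_smult add_left smult_left R1 n1 n2)
  then show ?case by (simp add: Q_def)
qed

lemma Q_eq_sum:
  assumes "\<And>i. i \<ge> n \<Longrightarrow> coeff q i = 0"
  shows "Q q = (\<Sum>k<n. (cmod (s q (basis k)))\<^sup>2)"
proof -
  have "s q q = s (residual n q) q + (\<Sum>k<n. s q (basis k) * s (basis k) q)"
    by (subst (1) basis_expansion[of q n]) (simp add: add_left sum_left smult_left)
  also have "\<dots> = (\<Sum>k<n. of_real ((cmod (s q (basis k)))\<^sup>2))"
    using null[OF Q_residual_eq_0[OF assms]] cnj_sym[of "basis _" q]
    unfolding complex_norm_square by simp
  finally show ?thesis by (simp add: Q_def)
qed

text \<open>Only an inequality, because some basis vectors may be \<open>0\<close>.\<close>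

lemma Q_basis_sum_le: "Q (\<Sum>k<n. Polynomial.smult (c k) (basis k)) \<le> (\<Sum>k<n. (cmod (c k))\<^sup>2)"
proof -
  let ?p = "\<Sum>k<n. Polynomial.smult (c k) (basis k)"
  have "s ?p ?p = (\<Sum>k<n. c k * s (basis k) ?p)" by (simp add: sum_left smult_left)
  also have "\<dots> = (\<Sum>k<n. of_real ((cmod (c k))\<^sup>2 * Q (basis k)))"
  proof (rule sum.cong)
    fix k assume "k \<in> {..<n}"
    have "s ?p (basis k) = (\<Sum>j<n. if j = k then c k * s (basis k) (basis k) else 0)"
      unfolding sum_left by (intro sum.cong) (auto simp: smult_left basis_orthogonal)
    also have "\<dots> = c k * s (basis k) (basis k)" using \<open>k \<in> {..<n}\<close> by simp
    finally have "s (basis k) ?p = cnj (c k) * s (basis k) (basis k)"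
      by (metis cnj_sym complex_cnj_mult)
    then show "c k * s (basis k) ?p = of_real ((cmod (c k))\<^sup>2 * Q (basis k))"
      unfolding of_real_mult complex_norm_square by (simp add: s_self)
  qed simp
  finally have "Q ?p = (\<Sum>k<n. (cmod (c k))\<^sup>2 * Q (basis k))"
    unfolding Q_def[of ?p] by (simp only: Re_sum Re_complex_of_real)
  also have "\<dots> \<le> (\<Sum>k<n. (cmod (c k))\<^sup>2)"
  proof (rule sum_mono)
    fix k
    have "Q (basis k) \<le> 1" using basis_cases[of k] by (auto simp: Q_def)
    then show "(cmod (c k))\<^sup>2 * Q (basis k) \<le> (cmod (c k))\<^sup>2"
      using mult_left_mono[of "Q (basis k)" 1 "(cmod (c k))\<^sup>2"] by simp
  qed
  finally show ?thesis .
qed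

end

section \<open>Bounded functionals as a complete inner product space\<close>

lemma cring_complex_ring: "cring complex_ring"
proof (rule cringI)
  show "abelian_group complex_ring"
    by (rule abelian_groupI) (auto simp: complex_ring_def intro: exI[of _ "- _"])
  show "Group.comm_monoid complex_ring"
    by (rule comm_monoidI) (auto simp: complex_ring_def)
qed (auto simp: complex_ring_def algebra_simps)

context semi_inner
begin

text \<open>The dual of the polynomials with the seminorm \<open>sqrt Q\<close>, functionals being identified with
  their values on the monomials.\<close>

definition bounded_by :: "real \<Rightarrow> (nat \<Rightarrow> complex) \<Rightarrow> bool" where
  "bounded_by c f \<longleftrightarrow> c \<ge> 0 \<and> (\<forall>q. (cmod (pairing f q))\<^sup>2 \<le> c * Q q)"

definition space :: "(nat \<Rightarrow> complex) set" where
  "space = {f. \<exists>c. bounded_by c f}"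

definition coord :: "(nat \<Rightarrow> complex) \<Rightarrow> nat \<Rightarrow> complex" where
  "coord f k = pairing f (basis k)"

text \<open>On \<open>space\<close> this is the square of the dual norm: by \<open>normsq_le\<close>
  and \<open>bounded_by_normsq\<close> it is the least constant admissible in
  \<open>bounded_by\<close>. In coordinates the norm visibly comes from an inner product.\<close>

definition normsq :: "(nat \<Rightarrow> complex) \<Rightarrow> real" where
  "normsq f = (\<Sum>k. (cmod (coord f k))\<^sup>2)"

definition inner_prod :: "(nat \<Rightarrow> complex) \<Rightarrow> (nat \<Rightarrow> complex) \<Rightarrow> complex" where
  "inner_prod f g = (\<Sum>k. coord f k * cnj (coord g k))"

text \<open>The functional is tested on the polynomial whose coefficients in the basis are its own
  coordinates. With \<open>?S\<close> the partial sum, boundedness and \<open>Q_basis_sum_le\<close>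
  give \<open>?S * ?S \<le> c * ?S\<close>.\<close>

lemma coord_sum_le:
  assumes "bounded_by c f"
  shows "(\<Sum>k<n. (cmod (coord f k))\<^sup>2) \<le> c"
proof -
  let ?S = "\<Sum>k<n. (cmod (coord f k))\<^sup>2"
  define q where "q = (\<Sum>k<n. Polynomial.smult (coord f k) (basis k))"
  have "pairing f q = of_real ?S"
    unfolding of_real_sum complex_norm_square q_def
    by (simp add: pairing_sum_right pairing_smult_right coord_def mult.commute)
  moreover have S0: "?S \<ge> 0" by (intro sum_nonneg) auto
  ultimately have "?S\<^sup>2 \<le> c * Q q"
    using assms unfolding bounded_by_def by (metis abs_of_nonneg norm_of_real)
  also have "\<dots> \<le> c * ?S"
    using assms Q_basis_sum_le unfolding q_def bounded_by_def by (intro mult_left_mono) auto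
  finally have le: "?S * ?S \<le> c * ?S" by (simp only: power2_eq_square)
  show ?thesis
  proof (rule ccontr)
    assume "\<not> ?S \<le> c"
    then have "c * ?S < ?S * ?S"
      using assms by (intro mult_strict_right_mono) (auto simp: bounded_by_def)
    then show False using le by linarith
  qed
qed

lemma coord_summable:
  assumes "f \<in> space"
  shows "summable (\<lambda>k. (cmod (coord f k))\<^sup>2)"
proof -
  obtain c where "bounded_by c f" using assms by (auto simp: space_def)
  then have "(\<Sum>k\<le>n. (cmod (coord f k))\<^sup>2) \<le> c" for n
    using coord_sum_le[of c f "Suc n"] by (simp add: lessThan_Suc_atMost)
  then show ?thesis by (intro bounded_imp_summable[of _ c]) auto
qed

lemma normsq_le: "bounded_by c f \<Longrightarrow> normsq f \<le> c"
  unfolding normsq_def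
  by (intro suminf_le_const coord_summable coord_sum_le) (auto simp: space_def)

lemma normsq_nonneg: "f \<in> space \<Longrightarrow> normsq f \<ge> 0"
  unfolding normsq_def by (intro suminf_nonneg coord_summable) auto

text \<open>A bounded functional annihilates the null residual of \<open>q\<close>, so its value at
  \<open>q\<close> is a finite sum over coordinates, to which the Cauchy-Schwarz inequality
  applies.\<close>

lemma bounded_by_normsq:
  assumes "f \<in> space"
  shows "bounded_by (normsq f) f"
proof -
  obtain c where c: "bounded_by c f" using assms by (auto simp: space_def)
  have "(cmod (pairing f q))\<^sup>2 \<le> normsq f * Q q" for q
  proof -
    define n where "n = Suc (degree q)"
    have n: "coeff q i = 0" if "i \<ge> n" for i
      using that by (intro coeff_eq_0) (simp add: n_def)
    have "(cmod (pairing f (residual n q)))\<^sup>2 \<le> 0"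
      using c Q_residual_eq_0[OF n] unfolding bounded_by_def by (metis mult_zero_right)
    then have "pairing f (residual n q) = 0" by simp
    then have "pairing f q = (\<Sum>k<n. cnj (s q (basis k)) * coord f k)"
      by (subst basis_expansion[of q n])
        (simp add: pairing_add_right pairing_sum_right pairing_smult_right coord_def)
    then have "cmod (pairing f q) \<le> (\<Sum>k<n. cmod (s q (basis k)) * cmod (coord f k))"
      by (simp add: norm_sum[THEN order_trans] norm_mult)
    then have "(cmod (pairing f q))\<^sup>2 \<le> (\<Sum>k<n. cmod (s q (basis k)) * cmod (coord f k))\<^sup>2"
      by (intro power_mono) auto
    also have "\<dots> \<le> (\<Sum>k<n. (cmod (s q (basis k)))\<^sup>2) * (\<Sum>k<n. (cmod (coord f k))\<^sup>2)"
      by (rule Cauchy_Schwarz_ineq_sum)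
    also have "(\<Sum>k<n. (cmod (s q (basis k)))\<^sup>2) = Q q"
      by (rule Q_eq_sum[OF n, symmetric])
    also have "Q q * (\<Sum>k<n. (cmod (coord f k))\<^sup>2) \<le> Q q * normsq f"
      unfolding normsq_def
      by (intro mult_left_mono sum_le_suminf coord_summable assms Q_nonneg) auto
    finally show ?thesis by (simp add: mult.commute)
  qed
  then show ?thesis using normsq_nonneg[OF assms] by (simp add: bounded_by_def)
qed

lemma pairing_le: "f \<in> space \<Longrightarrow> cmod (pairing f q) \<le> sqrt (normsq f) * sqrt (Q q)"
  using bounded_by_normsq[of f] unfolding bounded_by_def real_sqrt_mult[symmetric]
  by (auto intro: real_le_rsqrt)

lemma space_zero: "(\<lambda>i. 0) \<in> space"
  by (auto simp: space_def bounded_by_def pairing_def intro!: exI[of _ 0])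

lemma space_add:
  assumes "f \<in> space" "g \<in> space"
  shows "(\<lambda>i. f i + g i) \<in> space"
proof -
  have "(cmod (pairing f q + pairing g q))\<^sup>2 \<le> (2 * normsq f + 2 * normsq g) * Q q" for q
  proof -
    have "(cmod (pairing f q + pairing g q))\<^sup>2 \<le> (cmod (pairing f q) + cmod (pairing g q))\<^sup>2"
      by (intro power_mono norm_triangle_ineq) auto
    also have "\<dots> \<le> 2 * (cmod (pairing f q))\<^sup>2 + 2 * (cmod (pairing g q))\<^sup>2"
      using sum_squares_bound[of "cmod (pairing f q)" "cmod (pairing g q)"]
      by (simp add: power2_sum)
    also have "\<dots> \<le> 2 * (normsq f * Q q) + 2 * (normsq g * Q q)"
      using assms[THEN bounded_by_normsq] by (intro add_mono mult_left_mono) (auto simp: bounded_by_def)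
    finally show ?thesis by (simp add: algebra_simps)
  qed
  then show ?thesis
    using assms[THEN normsq_nonneg]
    by (auto simp: space_def bounded_by_def pairing_add_left intro!: exI[of _ "2 * normsq f + 2 * normsq g"])
qed

lemma space_mult:
  assumes "f \<in> space"
  shows "(\<lambda>i. c * f i) \<in> space"
proof -
  have "(cmod (c * pairing f q))\<^sup>2 \<le> ((cmod c)\<^sup>2 * normsq f) * Q q" for q
    using bounded_by_normsq[OF assms]
    by (auto simp: norm_mult power_mult_distrib bounded_by_def mult.assoc intro: mult_left_mono)
  then show ?thesis
    using normsq_nonneg[OF assms]
    by (auto simp: space_def bounded_by_def pairing_mult_left intro!: exI[of _ "(cmod c)\<^sup>2 * normsq f"])
qed

lemma space_diff:
  assumes "f \<in> space" "g \<in> space"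
  shows "(\<lambda>i. f i - g i) \<in> space"
  using space_add[OF assms(1) space_mult[OF assms(2), of "-1"]] by simp

lemma space_sum: "(\<And>p. p \<in> S \<Longrightarrow> v p \<in> space) \<Longrightarrow> (\<lambda>i. \<Sum>p\<in>S. v p i) \<in> space"
proof (induction S rule: infinite_finite_induct)
  case (insert p S)
  then have "(\<lambda>i. v p i + (\<Sum>p\<in>S. v p i)) \<in> space" by (intro space_add) auto
  then show ?case using insert.hyps by simp
qed (simp_all add: space_zero)

lemma inner_prod_summable:
  assumes "f \<in> space" "g \<in> space"
  shows "summable (\<lambda>k. coord f k * cnj (coord g k))"
proof (rule summable_comparison_test')
  show "summable (\<lambda>k. (cmod (coord f k))\<^sup>2 + (cmod (coord g k))\<^sup>2)"
    by (intro summable_add coord_summable assms)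
  show "cmod (coord f k * cnj (coord g k)) \<le> (cmod (coord f k))\<^sup>2 + (cmod (coord g k))\<^sup>2" for k
    using sum_squares_bound[of "cmod (coord f k)" "cmod (coord g k)"]
      mult_nonneg_nonneg[OF norm_ge_zero[of "coord f k"] norm_ge_zero[of "coord g k"]]
    unfolding norm_mult complex_mod_cnj by linarith
qed

lemma inner_prod_add_left:
  assumes "f \<in> space" "g \<in> space" "h \<in> space"
  shows "inner_prod (\<lambda>i. f i + g i) h = inner_prod f h + inner_prod g h"
  using suminf_add[OF inner_prod_summable[OF assms(1,3)] inner_prod_summable[OF assms(2,3)]]
  by (simp add: inner_prod_def coord_def pairing_add_left algebra_simps)

lemma inner_prod_mult_left:
  assumes "f \<in> space" "h \<in> space"
  shows "inner_prod (\<lambda>i. c * f i) h = c * inner_prod f h"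
  using suminf_mult[OF inner_prod_summable[OF assms], of c]
  by (simp add: inner_prod_def coord_def pairing_mult_left algebra_simps)

lemma inner_prod_cnj: "f \<in> space \<Longrightarrow> g \<in> space \<Longrightarrow> inner_prod g f = cnj (inner_prod f g)"
  unfolding inner_prod_def
  by (subst bounded_linear.suminf[OF bounded_linear_cnj])
    (simp_all add: inner_prod_summable mult.commute)

lemma inner_prod_self: "f \<in> space \<Longrightarrow> inner_prod f f = of_real (normsq f)"
  unfolding inner_prod_def normsq_def
  by (subst suminf_of_real[OF coord_summable]) (simp_all only: complex_norm_square)

lemma inner_prod_sum_left:
  "(\<And>p. p \<in> S \<Longrightarrow> v p \<in> space) \<Longrightarrow> g \<in> space \<Longrightarrow>
    inner_prod (\<lambda>i. \<Sum>p\<in>S. c p * v p i) g = (\<Sum>p\<in>S. c p * inner_prod (v p) g)"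
proof (induction S rule: infinite_finite_induct)
  case (insert p S)
  then show ?case
    by (simp add: inner_prod_add_left inner_prod_mult_left space_mult space_sum)
qed (simp_all add: inner_prod_def coord_def pairing_def)

definition hilb :: "(nat \<Rightarrow> complex) inner_module" where
  "hilb = \<lparr>carrier = space, mult = undefined, one = undefined, zero = \<lambda>i. 0,
    add = \<lambda>f g i. f i + g i, smult = \<lambda>c f i. c * f i, ip = inner_prod\<rparr>"

lemma hilb_simps [simp]:
  "carrier hilb = space" "zero hilb = (\<lambda>i. 0)" "add hilb f g = (\<lambda>i. f i + g i)"
  "module.smult hilb c f = (\<lambda>i. c * f i)" "ip hilb = inner_prod"
  by (simp_all add: hilb_def)

lemma hilb_abelian_group: "abelian_group hilb"
proof (rule abelian_groupI)
  fix f assume "f \<in> carrier hilb"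
  then show "\<exists>g\<in>carrier hilb. g \<oplus>\<^bsub>hilb\<^esub> f = \<zero>\<^bsub>hilb\<^esub>"
    using space_mult[of f "-1"] by (intro bexI[of _ "\<lambda>i. - f i"]) auto
qed (auto simp: space_add space_zero add.assoc add.commute)

lemma hilb_minus:
  assumes "f \<in> space" "g \<in> space"
  shows "f \<ominus>\<^bsub>hilb\<^esub> g = (\<lambda>i. f i - g i)"
proof -
  interpret abelian_group hilb by (rule hilb_abelian_group)
  have "\<ominus>\<^bsub>hilb\<^esub> g = (\<lambda>i. - g i)"
    using assms space_mult[of g "-1"] by (intro minus_equality) auto
  then show ?thesis by (simp add: a_minus_def)
qed

lemma hnorm_hilb: "f \<in> space \<Longrightarrow> hnorm hilb f = sqrt (normsq f)"
  by (simp add: hnorm_def inner_prod_self)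

text \<open>Evaluation at a monomial is bounded, so a Cauchy sequence converges at every index.
  Since \<open>pairing\<close> is a finite sum, the bounds defining \<open>space\<close> pass to
  this pointwise limit, and \<open>normsq_le\<close> turns them back into norm estimates.\<close>

lemma hilb_complete:
  assumes sp: "\<And>n. F n \<in> space"
    and Cauchy: "\<And>e. e > 0 \<Longrightarrow> \<exists>K. \<forall>m\<ge>K. \<forall>n\<ge>K. sqrt (normsq (\<lambda>i. F m i - F n i)) < e"
  shows "\<exists>g\<in>space. (\<lambda>n. sqrt (normsq (\<lambda>i. F n i - g i))) \<longlonglongrightarrow> 0"
proof -
  have sd: "(\<lambda>i. F m i - F n i) \<in> space" for m n by (intro space_diff sp)
  have "\<exists>g. (\<lambda>n. F n i) \<longlonglongrightarrow> g" for i
  proof -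
    have "Cauchy (\<lambda>n. F n i)"
    proof (rule CauchyI)
      fix e :: real assume e: "e > 0"
      \<comment> \<open>The summand \<open>1\<close> keeps the denominator positive when the
        monomial is a null vector.\<close>
      define d where "d = e / (sqrt (Q (monom 1 i)) + 1)"
      have den: "sqrt (Q (monom 1 i)) + 1 > 0" using Q_nonneg by (simp add: add_nonneg_pos)
      obtain K where K: "\<And>m n. m \<ge> K \<Longrightarrow> n \<ge> K \<Longrightarrow> sqrt (normsq (\<lambda>i. F m i - F n i)) < d"
        using Cauchy[of d] e den by (auto simp: d_def)
      have "cmod (F m i - F n i) < e" if "m \<ge> K" "n \<ge> K" for m n
      proof -
        have "cmod (F m i - F n i) \<le> sqrt (normsq (\<lambda>i. F m i - F n i)) * sqrt (Q (monom 1 i))"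
          using pairing_le[OF sd, of m n "monom 1 i"] by (simp add: pairing_monom)
        also have "\<dots> \<le> d * sqrt (Q (monom 1 i))"
          using K[OF that] Q_nonneg by (intro mult_right_mono) auto
        also have "\<dots> < e" using e den Q_nonneg by (simp add: d_def field_simps)
        finally show ?thesis .
      qed
      then show "\<exists>M. \<forall>m\<ge>M. \<forall>n\<ge>M. cmod (F m i - F n i) < e" by blast
    qed
    then show ?thesis using Cauchy_convergent convergent_def by blast
  qed
  then obtain g where g: "\<And>i. (\<lambda>n. F n i) \<longlonglongrightarrow> g i" by metis
  have close: "\<exists>K. \<forall>n\<ge>K. bounded_by (e\<^sup>2) (\<lambda>i. F n i - g i)" if e: "e > 0" for e
  proof -
    obtain K where K: "\<And>m n. m \<ge> K \<Longrightarrow> n \<ge> K \<Longrightarrow> sqrt (normsq (\<lambda>i. F m i - F n i)) < e"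
      using Cauchy[OF e] by blast
    have "cmod (pairing (\<lambda>i. F n i - g i) q) \<le> e * sqrt (Q q)" if n: "n \<ge> K" for n q
    proof (rule LIMSEQ_le_const2)
      show "(\<lambda>m. cmod (pairing (\<lambda>i. F n i - F m i) q)) \<longlonglongrightarrow> cmod (pairing (\<lambda>i. F n i - g i) q)"
        by (intro tendsto_norm pairing_LIMSEQ tendsto_intros g)
      have "cmod (pairing (\<lambda>i. F n i - F m i) q) \<le> e * sqrt (Q q)" if "m \<ge> K" for m
        using pairing_le[OF sd, of n m q] K[OF n that] Q_nonneg[of q]
        by (meson less_imp_le mult_right_mono order_trans real_sqrt_ge_zero)
      then show "\<exists>N. \<forall>m\<ge>N. cmod (pairing (\<lambda>i. F n i - F m i) q) \<le> e * sqrt (Q q)" by blast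
    qed
    then have "(cmod (pairing (\<lambda>i. F n i - g i) q))\<^sup>2 \<le> (e * sqrt (Q q))\<^sup>2" if n: "n \<ge> K" for n q
      using that by (intro power_mono) auto
    then show ?thesis using Q_nonneg by (auto simp: bounded_by_def power_mult_distrib)
  qed
  have "g \<in> space"
  proof -
    obtain K where "bounded_by (1\<^sup>2) (\<lambda>i. F K i - g i)" using close[of 1] by auto
    then have "(\<lambda>i. F K i - g i) \<in> space" unfolding space_def by blast
    then have "(\<lambda>i. F K i - (F K i - g i)) \<in> space" by (rule space_diff[OF sp])
    then show ?thesis by simp
  qed
  moreover have "(\<lambda>n. sqrt (normsq (\<lambda>i. F n i - g i))) \<longlonglongrightarrow> 0"
  proof (rule LIMSEQ_I)
    fix e :: real assume e: "e > 0"
    obtain K where K: "\<And>n. n \<ge> K \<Longrightarrow> bounded_by ((e/2)\<^sup>2) (\<lambda>i. F n i - g i)"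
      using close[of "e/2"] e by auto
    have "norm (sqrt (normsq (\<lambda>i. F n i - g i)) - 0) < e" if "n \<ge> K" for n
    proof -
      have "(\<lambda>i. F n i - g i) \<in> space" using K[OF that] unfolding space_def by blast
      then have "0 \<le> normsq (\<lambda>i. F n i - g i)" by (rule normsq_nonneg)
      moreover have "sqrt (normsq (\<lambda>i. F n i - g i)) \<le> sqrt ((e/2)\<^sup>2)"
        using normsq_le[OF K[OF that]] by (rule real_sqrt_le_mono)
      ultimately show ?thesis using e by simp
    qed
    then show "\<exists>no. \<forall>n\<ge>no. norm (sqrt (normsq (\<lambda>i. F n i - g i)) - 0) < e" by blast
  qed
  ultimately show ?thesis by blast
qed

lemma normsq_eq_0:
  assumes "f \<in> space" "normsq f = 0"
  shows "f = (\<lambda>i. 0)"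
proof
  fix i show "f i = 0"
    using pairing_le[OF assms(1), of "monom 1 i"] assms(2) by (simp add: pairing_monom)
qed

lemma hilbert_space_hilb: "hilbert_space hilb"
proof -
  have "Module.module complex_ring hilb"
    by (intro Module.module.intro cring_complex_ring hilb_abelian_group module_axioms.intro)
      (auto simp: complex_ring_def space_mult algebra_simps)
  then interpret Module.module complex_ring hilb .
  show ?thesis
  proof
    fix F :: "nat \<Rightarrow> nat \<Rightarrow> complex"
    assume F: "range F \<subseteq> carrier hilb"
      and C: "\<forall>e>0. \<exists>K. \<forall>m\<ge>K. \<forall>n\<ge>K. hnorm hilb (F m \<ominus>\<^bsub>hilb\<^esub> F n) < e"
    have sp: "\<And>n. F n \<in> space" using F by auto
    have "hnorm hilb (F m \<ominus>\<^bsub>hilb\<^esub> g) = sqrt (normsq (\<lambda>i. F m i - g i))" if "g \<in> space" for m g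
      using sp that by (simp add: hilb_minus hnorm_hilb space_diff)
    then show "\<exists>x\<in>carrier hilb. (\<lambda>n. hnorm hilb (F n \<ominus>\<^bsub>hilb\<^esub> x)) \<longlonglongrightarrow> 0"
      using hilb_complete[of F] sp C by auto
  next
    fix f g assume "f \<in> carrier hilb" "g \<in> carrier hilb"
    then show "ip hilb g f = cnj (ip hilb f g)" using inner_prod_cnj[of f g] by simp
  qed (auto simp: inner_prod_add_left inner_prod_mult_left inner_prod_self normsq_nonneg normsq_eq_0)
qed

end

subsection \<open>The coisometric realization of a contractive power series\<close>

lemma norm_vec2: "(norm (u :: complex ^ 2))\<^sup>2 = (cmod (u $ 1))\<^sup>2 + (cmod (u $ 2))\<^sup>2"
  by (simp add: norm_vec_def L2_set_def sum_2)

lemma three_term_Cauchy_Schwarz: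
  "(a * x + b * y + c * z)\<^sup>2 \<le> (a\<^sup>2 + b\<^sup>2 + c\<^sup>2) * (x\<^sup>2 + y\<^sup>2 + z\<^sup>2)" for a b c x y z :: real
proof -
  have "(a\<^sup>2 + b\<^sup>2 + c\<^sup>2) * (x\<^sup>2 + y\<^sup>2 + z\<^sup>2) - (a * x + b * y + c * z)\<^sup>2 =
    (a * y - b * x)\<^sup>2 + (a * z - c * x)\<^sup>2 + (b * z - c * y)\<^sup>2"
    by (simp add: power2_eq_square algebra_simps)
  then show ?thesis by (smt (verit) zero_le_power2)
qed

section \<open>Backward shift and evaluation on interleaved sequences\<close>

definition prepend :: "complex ^ 2 \<Rightarrow> complex poly \<Rightarrow> complex poly" where
  "prepend w q = pCons (w $ 1) (pCons (w $ 2) q)"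

text \<open>The backward shift on power series with coefficients in C^2: one vector coefficient
  occupies two scalar places.\<close>

definition shift2 :: "(nat \<Rightarrow> complex) \<Rightarrow> nat \<Rightarrow> complex" where
  "shift2 f i = f (i + 2)"

definition head2 :: "(nat \<Rightarrow> complex) \<Rightarrow> complex ^ 2" where
  "head2 f = vector [f 0, f 1]"

lemma head2_nth [simp]: "head2 f $ 1 = f 0" "head2 f $ 2 = f 1"
  by (simp_all add: head2_def)

text \<open>Prepending a vector is adjoint to splitting a sequence into its head and its backward
  shift.\<close>

lemma pairing_prepend:
  "pairing f (prepend w q) = f 0 * cnj (w $ 1) + f 1 * cnj (w $ 2) + pairing (shift2 f) q"
  by (simp add: prepend_def pairing_pCons shift2_def[abs_def])

lemma degree_prepend: "degree (prepend w q) \<le> degree q + 2"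
  using degree_pCons_le[of "w $ 1" "pCons (w $ 2) q"] degree_pCons_le[of "w $ 2" q]
  by (simp add: prepend_def)

lemma poly_shift_prepend: "poly_shift (2 * Suc m) (prepend w q) = poly_shift (2 * m) q"
  by (simp add: poly_eq_iff coeff_poly_shift prepend_def)

text \<open>A sequence in \<open>\<complex>\<^sup>2\<close> is interleaved into one scalar sequence. Accordingly a \<open>2 \<times> 2\<close> matrix
  power series is encoded by its two columns: \<open>\<Phi> a\<close> lists, coefficient by coefficient, the two
  entries of column \<open>a\<close>. The hypothesis says that the adjoint of the block Toeplitz operator of the
  series is contractive.\<close>

locale contractive_series =
  fixes \<Phi> :: "2 \<Rightarrow> nat \<Rightarrow> complex"
  assumes Toeplitz_le: "(\<Sum>m\<le>degree q. \<Sum>a\<in>UNIV. (cmod (pairing (\<Phi> a) (poly_shift (2 * m) q)))\<^sup>2)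
    \<le> (\<Sum>i\<le>degree q. (cmod (coeff q i))\<^sup>2)"
begin

text \<open>Let \<open>T\<close> be the block Toeplitz operator of the series. The conjugate of
  \<open>pairing (\<Phi> a) (poly_shift (2 * m) q)\<close> is component \<open>a\<close> of
  coefficient \<open>m\<close> of the adjoint of \<open>T\<close> applied to \<open>q\<close>, so
  this is the inner product of the images of \<open>p\<close> and \<open>q\<close> under that
  adjoint. Beyond \<open>degree q\<close> the shifted polynomial is \<open>0\<close>.\<close>

definition output_form :: "complex poly \<Rightarrow> complex poly \<Rightarrow> complex" where
  "output_form p q = (\<Sum>m\<le>degree q. \<Sum>a\<in>UNIV.
    cnj (pairing (\<Phi> a) (poly_shift (2 * m) p)) * pairing (\<Phi> a) (poly_shift (2 * m) q))"

text \<open>The form of the identity minus \<open>T\<close> times its adjoint, whose dual is the de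
  Branges-Rovnyak space in coefficient form. It can be degenerate: for a constant unitary matrix it
  vanishes identically.\<close>

definition form :: "complex poly \<Rightarrow> complex poly \<Rightarrow> complex" where
  "form p q = pairing (coeff p) q - output_form p q"

lemma output_form_eq:
  assumes "degree q \<le> N"
  shows "output_form p q = (\<Sum>m\<le>N. \<Sum>a\<in>UNIV.
    cnj (pairing (\<Phi> a) (poly_shift (2 * m) p)) * pairing (\<Phi> a) (poly_shift (2 * m) q))"
proof -
  have "poly_shift (2 * m) q = 0" if "m > degree q" for m
    using that by (simp add: poly_eq_iff coeff_poly_shift coeff_eq_0)
  then show ?thesis
    unfolding output_form_def using assms by (intro sum.mono_neutral_left) auto
qed

text \<open>The term for \<open>m = 0\<close> is the extra sum; every later shift of the longer
  polynomials is the preceding shift of \<open>p\<close> and \<open>q\<close>.\<close>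

lemma output_form_prepend:
  "output_form (prepend w p) (prepend w' q) = output_form p q +
    (\<Sum>a\<in>UNIV. cnj (pairing (\<Phi> a) (prepend w p)) * pairing (\<Phi> a) (prepend w' q))"
proof -
  have "degree (prepend w' q) \<le> Suc (Suc (degree q))" using degree_prepend by simp
  then show ?thesis
    by (subst output_form_eq[of _ "Suc (Suc (degree q))"], assumption,
        subst output_form_eq[of q "Suc (degree q)"], simp,
        subst sum.atMost_Suc_shift) (simp add: poly_shift_prepend del: sum.atMost_Suc mult_Suc_right)
qed

sublocale semi_inner form
proof
  have ps_add: "poly_shift k (p + q) = poly_shift k p + poly_shift k q" for k and p q :: "complex poly"
    by (simp add: poly_eq_iff coeff_poly_shift)
  have ps_smult: "poly_shift k (Polynomial.smult c p) = Polynomial.smult c (poly_shift k p)" for k c and p :: "complex poly"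
    by (simp add: poly_eq_iff coeff_poly_shift)
  fix p p' q :: "complex poly" and c :: complex
  have coeff_add': "coeff (p + p') = (\<lambda>i. coeff p i + coeff p' i)"
    and coeff_smult': "coeff (Polynomial.smult c p) = (\<lambda>i. c * coeff p i)" by auto
  show "form (p + p') q = form p q + form p' q"
    unfolding form_def coeff_add' pairing_add_left
    by (simp add: output_form_def ps_add pairing_add_right algebra_simps sum.distrib)
  show "form (Polynomial.smult c p) q = c * form p q"
    unfolding form_def coeff_smult' pairing_mult_left
    by (simp add: output_form_def ps_smult pairing_smult_right algebra_simps sum_distrib_left)
  show "form q p = cnj (form p q)"
  proof -
    define N where "N = max (degree p) (degree q)"
    have N: "degree p \<le> N" "degree q \<le> N" by (auto simp: N_def)
    show ?thesis
      unfolding form_def output_form_eq[OF N(1)] output_form_eq[OF N(2)]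
      by (simp add: pairing_cnj[of q p] mult.commute)
  qed
  have "output_form p p = of_real (\<Sum>m\<le>degree p. \<Sum>a\<in>UNIV. (cmod (pairing (\<Phi> a) (poly_shift (2 * m) p)))\<^sup>2)"
    unfolding output_form_def of_real_sum complex_norm_square by (simp add: mult.commute)
  moreover have "pairing (coeff p) p = of_real (\<Sum>i\<le>degree p. (cmod (coeff p i))\<^sup>2)"
    unfolding pairing_def of_real_sum complex_norm_square by simp
  ultimately show "0 \<le> Re (form p p)"
    unfolding form_def using Toeplitz_le[of p] by (simp del: of_real_sum)
qed

text \<open>Prepending adds the squared norm of \<open>w\<close> to the coefficient pairing and the
  \<open>m = 0\<close> term to \<open>output_form\<close>. Moving the latter to the left gives the
  norm identity.\<close>

lemma Q_prepend:
  "Q (prepend w q) + (\<Sum>a\<in>UNIV. (cmod (pairing (\<Phi> a) (prepend w q)))\<^sup>2) = (norm w)\<^sup>2 + Q q"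
proof -
  let ?P = "prepend w q"
  have "shift2 (coeff ?P) = coeff q" "coeff ?P 0 = w $ 1" "coeff ?P 1 = w $ 2"
    by (auto simp: shift2_def prepend_def)
  then have 1: "pairing (coeff ?P) ?P = w $ 1 * cnj (w $ 1) + w $ 2 * cnj (w $ 2) + pairing (coeff q) q"
    by (simp add: pairing_prepend)
  have "form ?P ?P + (\<Sum>a\<in>UNIV. pairing (\<Phi> a) ?P * cnj (pairing (\<Phi> a) ?P))
    = (w $ 1 * cnj (w $ 1) + w $ 2 * cnj (w $ 2)) + form q q"
    unfolding form_def[of ?P ?P] 1 output_form_prepend by (simp add: form_def mult.commute)
  then have "of_real (Q ?P + (\<Sum>a\<in>UNIV. (cmod (pairing (\<Phi> a) ?P))\<^sup>2)) = complex_of_real ((norm w)\<^sup>2 + Q q)"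
    unfolding of_real_add of_real_sum complex_norm_square norm_vec2 s_self .
  then show ?thesis by (simp only: of_real_eq_iff)
qed

text \<open>The interleaved coefficients of the matrix series applied to the constant vector
  \<open>u\<close>.\<close>

definition input_seq :: "complex ^ 2 \<Rightarrow> nat \<Rightarrow> complex" where
  "input_seq u i = u $ 1 * \<Phi> 1 i + u $ 2 * \<Phi> 2 i"

lemma pairing_input_seq: "pairing (input_seq u) q = u $ 1 * pairing (\<Phi> 1) q + u $ 2 * pairing (\<Phi> 2) q"
  unfolding input_seq_def[abs_def] by (simp only: pairing_add_left pairing_mult_left)

text \<open>The adjoint of the colligation sends \<open>(w, q)\<close> to \<open>prepend w q\<close> together with its pairings with
  the columns of the series; by \<open>Q_prepend\<close> it is isometric, so the colligation is
  contractive by duality.\<close>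

lemma step_pairing_le:
  assumes "f \<in> space"
  shows "(cmod (pairing (\<lambda>i. input_seq u i + f i) (prepend w q)))\<^sup>2
    \<le> ((norm u)\<^sup>2 + normsq f) * ((norm w)\<^sup>2 + Q q)"
proof -
  let ?P = "prepend w q"
  have "cmod (pairing (\<lambda>i. input_seq u i + f i) ?P) \<le>
    cmod (u $ 1) * cmod (pairing (\<Phi> 1) ?P) + cmod (u $ 2) * cmod (pairing (\<Phi> 2) ?P)
      + sqrt (normsq f) * sqrt (Q ?P)"
    unfolding pairing_add_left pairing_input_seq norm_mult[symmetric]
    by (intro order_trans[OF norm_triangle_ineq] add_mono norm_triangle_ineq pairing_le assms)
  then have "(cmod (pairing (\<lambda>i. input_seq u i + f i) ?P))\<^sup>2 \<le>
    (cmod (u $ 1) * cmod (pairing (\<Phi> 1) ?P) + cmod (u $ 2) * cmod (pairing (\<Phi> 2) ?P)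
      + sqrt (normsq f) * sqrt (Q ?P))\<^sup>2"
    by (intro power_mono) auto
  also have "\<dots> \<le> ((cmod (u $ 1))\<^sup>2 + (cmod (u $ 2))\<^sup>2 + (sqrt (normsq f))\<^sup>2) *
      ((cmod (pairing (\<Phi> 1) ?P))\<^sup>2 + (cmod (pairing (\<Phi> 2) ?P))\<^sup>2 + (sqrt (Q ?P))\<^sup>2)"
    by (rule three_term_Cauchy_Schwarz)
  also have "\<dots> = ((norm u)\<^sup>2 + normsq f) * ((norm w)\<^sup>2 + Q q)"
    unfolding Q_prepend[symmetric] norm_vec2[of u]
    using normsq_nonneg[OF assms] Q_nonneg by (simp add: sum_2 algebra_simps)
  finally show ?thesis .
qed

text \<open>In \<open>key\<close> the output is tested against \<open>w = head2 h\<close> and the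
  polynomial \<open>q\<close> built from finitely many coordinates of \<open>shift2 h\<close>. The
  partial squared norm \<open>t\<close> of the output then satisfies
  \<open>t * t \<le> E * t\<close>, and the number of coordinates is arbitrary.\<close>

lemma colligation_contractive:
  fixes u
  assumes f: "f \<in> space"
  defines "h \<equiv> \<lambda>i. input_seq u i + f i"
  shows "shift2 h \<in> space" "(norm (head2 h))\<^sup>2 + normsq (shift2 h) \<le> (norm u)\<^sup>2 + normsq f"
proof -
  define E where "E = (norm u)\<^sup>2 + normsq f"
  have E0: "E \<ge> 0" using normsq_nonneg[OF f] by (simp add: E_def)
  have key: "(cmod (h 0 * cnj (w $ 1) + h 1 * cnj (w $ 2) + pairing (shift2 h) q))\<^sup>2 \<le> E * ((norm w)\<^sup>2 + Q q)" for w :: "complex ^ 2" and q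
    using step_pairing_le[OF f, of u w q] unfolding h_def[symmetric] pairing_prepend E_def .
  \<comment> \<open>The choice \<open>w = 0\<close> isolates the shifted part, so that its
    membership in \<open>space\<close> is known before its norm is estimated.\<close>
  have "bounded_by E (shift2 h)"
    using key[of 0] E0 by (auto simp: bounded_by_def)
  then show sp: "shift2 h \<in> space" unfolding space_def by blast
  define w where "w = head2 h"
  have ww: "h 0 * cnj (w $ 1) + h 1 * cnj (w $ 2) = of_real ((norm w)\<^sup>2)"
    unfolding norm_vec2 of_real_add complex_norm_square by (simp add: w_def)
  have "(\<Sum>k<n. (cmod (coord (shift2 h) k))\<^sup>2) \<le> E - (norm w)\<^sup>2" for n
  proof -
    let ?S = "\<Sum>k<n. (cmod (coord (shift2 h) k))\<^sup>2"
    define q where "q = (\<Sum>k<n. Polynomial.smult (coord (shift2 h) k) (basis k))"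
    have S: "pairing (shift2 h) q = of_real ?S"
      unfolding of_real_sum complex_norm_square q_def
      by (simp add: pairing_sum_right pairing_smult_right coord_def mult.commute)
    have Qq: "Q q \<le> ?S" unfolding q_def by (rule Q_basis_sum_le)
    have S0: "?S \<ge> 0" by (intro sum_nonneg) auto
    define t where "t = (norm w)\<^sup>2 + ?S"
    have t0: "t \<ge> 0" using S0 by (simp add: t_def)
    have "t\<^sup>2 \<le> E * ((norm w)\<^sup>2 + Q q)"
      using key[of w q] t0 unfolding ww S of_real_add[symmetric] norm_of_real t_def by simp
    also have "\<dots> \<le> E * t" using Qq E0 by (intro mult_left_mono) (auto simp: t_def)
    finally have le: "t * t \<le> E * t" by (simp only: power2_eq_square)
    have "t \<le> E"
    proof (rule ccontr)
      assume "\<not> t \<le> E"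
      then have "E * t < t * t" using E0 by (intro mult_strict_right_mono) auto
      then show False using le by linarith
    qed
    then show ?thesis by (simp add: t_def)
  qed
  then have "normsq (shift2 h) \<le> E - (norm w)\<^sup>2"
    unfolding normsq_def by (intro suminf_le_const coord_summable sp)
  then show "(norm (head2 h))\<^sup>2 + normsq (shift2 h) \<le> (norm u)\<^sup>2 + normsq f"
    by (simp add: E_def w_def)
qed

lemma normsq_zero: "normsq (\<lambda>i. 0) = 0"
  by (simp add: normsq_def coord_def pairing_def)

lemma input_seq_zero: "input_seq 0 = (\<lambda>i. 0)"
  by (simp add: input_seq_def[abs_def])

lemma shift2_space:
  assumes "f \<in> space"
  shows "shift2 f \<in> space" "normsq (shift2 f) \<le> normsq f"
proof -
  have "shift2 f \<in> space \<and> (norm (head2 f))\<^sup>2 + normsq (shift2 f) \<le> normsq f"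
    using colligation_contractive[OF assms, of 0] by (simp add: input_seq_zero)
  then show "shift2 f \<in> space" "normsq (shift2 f) \<le> normsq f"
    using zero_le_power2[of "norm (head2 f)"] by linarith+
qed

lemma shift2_input_seq_space:
  "shift2 (input_seq u) \<in> space" "normsq (shift2 (input_seq u)) \<le> (norm u)\<^sup>2"
proof -
  have "shift2 (input_seq u) \<in> space \<and>
      (norm (head2 (input_seq u)))\<^sup>2 + normsq (shift2 (input_seq u)) \<le> (norm u)\<^sup>2"
    using colligation_contractive[OF space_zero, of u] by (simp add: normsq_zero)
  then show "shift2 (input_seq u) \<in> space" "normsq (shift2 (input_seq u)) \<le> (norm u)\<^sup>2"
    using zero_le_power2[of "norm (head2 (input_seq u))"] by linarith+
qed

section \<open>The colligation and its transfer function\<close>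

definition opA :: "complex ^ 2 ^ 2" where
  "opA = vector [vector [\<Phi> 1 0, \<Phi> 2 0], vector [\<Phi> 1 1, \<Phi> 2 1]]"

definition opC :: "complex ^ 2 \<Rightarrow> nat \<Rightarrow> complex" where
  "opC u = shift2 (input_seq u)"

lemma opA_mult: "opA *v u = head2 (input_seq u)"
  by (simp add: vec_eq_iff forall_2 opA_def matrix_vector_mult_def sum_2 input_seq_def mult.commute)

lemma head2_add: "head2 (\<lambda>i. f i + g i) = head2 f + head2 g"
  by (simp add: vec_eq_iff forall_2)

lemma block_op_hilb:
  "block_op hilb opA head2 opC shift2 (u, f) =
    (head2 (\<lambda>i. input_seq u i + f i), shift2 (\<lambda>i. input_seq u i + f i))"
  by (simp add: block_op_def opA_mult head2_add opC_def shift2_def[abs_def])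

lemma contraction_blocks_hilb: "contraction_blocks hilb opA head2 opC shift2"
  unfolding contraction_blocks_def
proof (intro conjI ballI)
  have "opC u \<in> space" "f \<in> space \<Longrightarrow> shift2 f \<in> space" for u f
    by (simp_all add: opC_def shift2_space shift2_input_seq_space)
  then show "linear_blocks hilb head2 opC shift2"
    unfolding linear_blocks_def
    by (simp add: head2_add vec_eq_iff forall_2)
      (simp add: fun_eq_iff opC_def shift2_def input_seq_def algebra_simps)
  fix w :: "(complex ^ 2) \<times> (nat \<Rightarrow> complex)"
  assume "w \<in> UNIV \<times> carrier hilb"
  then obtain u f where w: "w = (u, f)" "f \<in> space" by auto
  show "sum_norm hilb (block_op hilb opA head2 opC shift2 w) \<le> sum_norm hilb w"
    using colligation_contractive[OF w(2), of u] normsq_nonneg w(2)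
    by (simp add: w(1) block_op_hilb sum_norm_def hnorm_hilb)
qed

text \<open>The sequences \<open>c k\<close> are the iterated backward shifts of
  \<open>shift2 (input_seq u)\<close>, which explains the offset \<open>2\<close>. Their norms are
  at most \<open>norm u\<close>, so the series is dominated by a geometric one; membership in
  \<open>space\<close> follows from bounds on the partial sums.\<close>

lemma summable_state:
  assumes "cmod l < 1"
  shows "summable (\<lambda>k. l ^ k * input_seq u (i + 2 * k + 2))"
    and "(\<lambda>i. \<Sum>k. l ^ k * input_seq u (i + 2 * k + 2)) \<in> space"
proof -
  define c where "c k i = input_seq u (i + 2 * k + 2)" for k i
  have c: "c k \<in> space \<and> normsq (c k) \<le> (norm u)\<^sup>2" for k
  proof (induction k)
    case 0
    then show ?case using shift2_input_seq_space[of u] by (simp add: c_def[abs_def] shift2_def[abs_def])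
  next
    case (Suc k)
    have "c (Suc k) = shift2 (c k)" by (auto simp: c_def shift2_def)
    then show ?case using shift2_space[of "c k"] Suc by auto
  qed
  have bd: "cmod (pairing (c k) q) \<le> norm u * sqrt (Q q)" for k q
  proof -
    have "sqrt (normsq (c k)) \<le> norm u" using c by (simp add: real_le_lsqrt normsq_nonneg)
    then have "sqrt (normsq (c k)) * sqrt (Q q) \<le> norm u * sqrt (Q q)"
      using Q_nonneg by (intro mult_right_mono) auto
    then show ?thesis using pairing_le[of "c k" q] c by force
  qed
  have sum: "summable (\<lambda>k. l ^ k * c k i)" for i
  proof (rule summable_comparison_test')
    show "summable (\<lambda>k. cmod l ^ k * (norm u * sqrt (Q (monom 1 i))))"
      using assms by (intro summable_mult2 summable_geometric) auto
    show "norm (l ^ k * c k i) \<le> cmod l ^ k * (norm u * sqrt (Q (monom 1 i)))" for k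
      using bd[of k "monom 1 i"] by (auto simp: norm_mult norm_power pairing_monom intro: mult_left_mono)
  qed
  then show "summable (\<lambda>k. l ^ k * input_seq u (i + 2 * k + 2))" by (simp add: c_def)
  define v where "v i = (\<Sum>k. l ^ k * c k i)" for i
  define M where "M = norm u / (1 - cmod l)"
  have "cmod (pairing v q) \<le> M * sqrt (Q q)" for q
  proof (rule LIMSEQ_le_const2)
    show "(\<lambda>n. cmod (pairing (\<lambda>i. \<Sum>k<n. l ^ k * c k i) q)) \<longlonglongrightarrow> cmod (pairing v q)"
      unfolding v_def using sum by (intro tendsto_norm pairing_LIMSEQ summable_LIMSEQ)
    have "cmod (pairing (\<lambda>i. \<Sum>k<n. l ^ k * c k i) q) \<le> M * sqrt (Q q)" for n
    proof -
      have "pairing (\<lambda>i. \<Sum>k<n. l ^ k * c k i) q = (\<Sum>k<n. l ^ k * pairing (c k) q)"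
      proof (induction n)
        case (Suc n)
        then show ?case by (simp add: pairing_add_left pairing_mult_left)
      qed (simp add: pairing_def)
      also have "cmod \<dots> \<le> (\<Sum>k<n. cmod l ^ k * (norm u * sqrt (Q q)))"
        using bd by (intro sum_norm_le) (auto simp: norm_mult norm_power intro: mult_left_mono)
      also have "\<dots> = (\<Sum>k<n. cmod l ^ k) * (norm u * sqrt (Q q))" by (simp add: sum_distrib_right)
      also have "\<dots> \<le> (1 / (1 - cmod l)) * (norm u * sqrt (Q q))"
      proof (rule mult_right_mono)
        have "(\<Sum>k<n. cmod l ^ k) \<le> (\<Sum>k. cmod l ^ k)"
          using assms by (intro sum_le_suminf summable_geometric) auto
        then show "(\<Sum>k<n. cmod l ^ k) \<le> 1 / (1 - cmod l)" using assms by (simp add: suminf_geometric)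
      qed (use Q_nonneg in auto)
      finally show ?thesis by (simp add: M_def)
    qed
    then show "\<exists>N. \<forall>n\<ge>N. cmod (pairing (\<lambda>i. \<Sum>k<n. l ^ k * c k i) q) \<le> M * sqrt (Q q)" by blast
  qed
  then have "(cmod (pairing v q))\<^sup>2 \<le> (M * sqrt (Q q))\<^sup>2" for q by (intro power_mono) auto
  then have "bounded_by (M\<^sup>2) v" using Q_nonneg by (auto simp: bounded_by_def power_mult_distrib)
  then have "v \<in> space" unfolding space_def by blast
  then show "(\<lambda>i. \<Sum>k. l ^ k * input_seq u (i + 2 * k + 2)) \<in> space" by (simp add: v_def[abs_def] c_def)
qed

text \<open>The Neumann series of the inverse of \<open>I - l D\<close> applied to
  \<open>C u\<close>.\<close>

definition state :: "complex \<Rightarrow> complex ^ 2 \<Rightarrow> nat \<Rightarrow> complex" where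
  "state l u i = (\<Sum>k. l ^ k * input_seq u (i + 2 * k + 2))"

lemma state_space: "cmod l < 1 \<Longrightarrow> state l u \<in> space"
  unfolding state_def[abs_def] by (rule summable_state)

text \<open>Splitting off the first term of the series. At \<open>i = 0\<close> and
  \<open>i = 1\<close> the series are the two components of the matrix function at \<open>l\<close>
  applied to \<open>u\<close>.\<close>

lemma state_sums:
  assumes "cmod l < 1"
  shows "(\<lambda>k. l ^ k * input_seq u (i + 2 * k)) sums (input_seq u i + l * state l u i)"
proof -
  have "(\<lambda>k. l ^ k * input_seq u (i + 2 * k + 2)) sums state l u i"
    unfolding state_def using summable_state(1)[OF assms] by (rule summable_sums)
  then have "(\<lambda>k. l * (l ^ k * input_seq u (i + 2 * k + 2))) sums (l * state l u i)"
    by (rule sums_mult)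
  then have "(\<lambda>k. l ^ Suc k * input_seq u (i + 2 * Suc k)) sums (l * state l u i)"
    by (simp add: mult.assoc)
  then show ?thesis by (subst (asm) sums_Suc_iff) (simp add: add.commute)
qed

lemma state_eq:
  assumes "cmod l < 1"
  shows "state l u i = opC u i + l * state l u (i + 2)"
proof -
  have "(\<lambda>k. l ^ k * input_seq u (i + 2 + 2 * k)) sums (input_seq u (i + 2) + l * state l u (i + 2))"
    by (rule state_sums[OF assms])
  then show ?thesis
    by (simp add: state_def[of l u i] sums_iff opC_def shift2_def algebra_simps)
qed

lemma state_add: "cmod l < 1 \<Longrightarrow> state l (u + u') i = state l u i + state l u' i"
  unfolding state_def
  by (subst suminf_add[OF summable_state(1) summable_state(1)]) (auto simp: input_seq_def algebra_simps)

lemma state_mult: "cmod l < 1 \<Longrightarrow> state l (c *s u) i = c * state l u i"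
  unfolding state_def
  by (subst suminf_mult[OF summable_state(1), symmetric]) (auto simp: input_seq_def algebra_simps)

lemma normsq_mult:
  assumes "f \<in> space"
  shows "normsq (\<lambda>i. c * f i) = (cmod c)\<^sup>2 * normsq f"
  unfolding normsq_def suminf_mult[OF coord_summable[OF assms], symmetric]
  by (simp add: coord_def pairing_mult_left norm_mult power_mult_distrib)

text \<open>By \<open>state_eq\<close> the sequence \<open>state l u\<close> is a preimage of
  \<open>opC u\<close>. It is the only one: a difference \<open>d\<close> of two preimages equals
  \<open>l\<close> times its shift, so \<open>normsq d \<le> |l|^2 * normsq d\<close> and
  \<open>d = 0\<close>.\<close>

lemma resolvent_eq_state:
  assumes l: "cmod l < 1"
  shows "inv_into (carrier hilb) (\<lambda>m. m \<ominus>\<^bsub>hilb\<^esub> shift2 (l \<odot>\<^bsub>hilb\<^esub> m)) (opC u) = state l u"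
proof (rule inv_into_f_eq)
  have minus: "m \<ominus>\<^bsub>hilb\<^esub> shift2 (l \<odot>\<^bsub>hilb\<^esub> m) = (\<lambda>i. m i - l * m (i + 2))" if "m \<in> space" for m
    using that by (subst hilb_minus) (auto simp: space_mult shift2_space shift2_def)
  show "inj_on (\<lambda>m. m \<ominus>\<^bsub>hilb\<^esub> shift2 (l \<odot>\<^bsub>hilb\<^esub> m)) (carrier hilb)"
  proof (rule inj_onI)
    fix f g assume fg: "f \<in> carrier hilb" "g \<in> carrier hilb"
      and eq: "f \<ominus>\<^bsub>hilb\<^esub> shift2 (l \<odot>\<^bsub>hilb\<^esub> f) = g \<ominus>\<^bsub>hilb\<^esub> shift2 (l \<odot>\<^bsub>hilb\<^esub> g)"
    define d where "d i = f i - g i" for i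
    have d: "d \<in> space" unfolding d_def[abs_def] using fg by (intro space_diff) auto
    have "f i - l * f (i + 2) = g i - l * g (i + 2)" for i
      using eq fg minus by (metis hilb_simps(1))
    then have "d = (\<lambda>i. l * shift2 d i)"
      by (auto simp: d_def shift2_def algebra_simps)
    then have "normsq d = (cmod l)\<^sup>2 * normsq (shift2 d)"
      by (metis normsq_mult shift2_space(1) d)
    also have "\<dots> \<le> (cmod l)\<^sup>2 * normsq d"
      using shift2_space(2)[OF d] by (intro mult_left_mono) auto
    finally have "(1 - (cmod l)\<^sup>2) * normsq d \<le> 0" by (simp add: algebra_simps)
    moreover have "1 - (cmod l)\<^sup>2 > 0" using l by (simp add: abs_square_less_1)
    ultimately have "normsq d = 0" using normsq_nonneg[OF d] by (simp add: mult_le_0_iff)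
    then have "d = (\<lambda>i. 0)" by (rule normsq_eq_0[OF d])
    then show "f = g" by (auto simp: d_def fun_eq_iff)
  qed
  show "state l u \<in> carrier hilb" using state_space[OF l] by simp
  show "state l u \<ominus>\<^bsub>hilb\<^esub> shift2 (l \<odot>\<^bsub>hilb\<^esub> state l u) = opC u"
    unfolding minus[OF state_space[OF l]]
  proof (rule ext)
    fix i show "state l u i - l * state l u (i + 2) = opC u i"
      using state_eq[OF l, of u i] by (simp add: diff_eq_eq)
  qed
qed

lemma Theta_mult:
  assumes l: "cmod l < 1"
  shows "Theta hilb opA head2 opC shift2 l *v u = head2 (\<lambda>i. input_seq u i + l * state l u i)"
proof -
  \<comment> \<open>Linearity ensures that \<open>matrix\<close> in \<open>Theta\<close> represents
    this map.\<close>
  have "Vector_Spaces.linear (*s) (*s) (\<lambda>u. head2 (\<lambda>i. l * state l u i))"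
    by unfold_locales (auto simp: vec_eq_iff forall_2 state_add[OF l] state_mult[OF l] algebra_simps)
  then show ?thesis
    unfolding Theta_def resolvent_eq_state[OF l]
    by (simp add: matrix_vector_mult_add_rdistrib opA_mult matrix_works head2_add)
qed

lemma Theta_nth:
  assumes "cmod l < 1"
  shows "(\<lambda>k. l ^ k * \<Phi> a (2 * k)) sums (Theta hilb opA head2 opC shift2 l $ 1 $ a)"
    and "(\<lambda>k. l ^ k * \<Phi> a (1 + 2 * k)) sums (Theta hilb opA head2 opC shift2 l $ 2 $ a)"
proof -
  have in_seq: "input_seq (axis a 1) = \<Phi> a"
    using exhaust_2[of a] by (auto simp: input_seq_def axis_def fun_eq_iff)
  have "Theta hilb opA head2 opC shift2 l *v axis a 1 = (\<chi> i. Theta hilb opA head2 opC shift2 l $ i $ a)"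
    using exhaust_2[of a] by (auto simp: vec_eq_iff matrix_vector_mult_def axis_def sum_2)
  then have "Theta hilb opA head2 opC shift2 l $ 1 $ a = input_seq (axis a 1) 0 + l * state l (axis a 1) 0"
    "Theta hilb opA head2 opC shift2 l $ 2 $ a = input_seq (axis a 1) 1 + l * state l (axis a 1) 1"
    by (simp_all add: Theta_mult[OF assms] vec_eq_iff forall_2)
  then show "(\<lambda>k. l ^ k * \<Phi> a (2 * k)) sums (Theta hilb opA head2 opC shift2 l $ 1 $ a)"
    "(\<lambda>k. l ^ k * \<Phi> a (1 + 2 * k)) sums (Theta hilb opA head2 opC shift2 l $ 2 $ a)"
    using state_sums[OF assms, of "axis a 1" 0] state_sums[OF assms, of "axis a 1" 1]
    by (simp_all add: in_seq)
qed

text \<open>This is the interpolation equation of step (3), with \<open>state l u\<close> as the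
  vector in the Hilbert space.\<close>

lemma block_op_state:
  assumes l: "cmod l < 1"
  shows "block_op hilb opA head2 opC shift2 (u, l \<odot>\<^bsub>hilb\<^esub> state l u) =
    (Theta hilb opA head2 opC shift2 l *v u, state l u)"
proof -
  have "shift2 (\<lambda>i. input_seq u i + l * state l u i) = state l u"
  proof (rule ext)
    fix i show "shift2 (\<lambda>i. input_seq u i + l * state l u i) i = state l u i"
      using state_eq[OF l, of u i] by (simp add: shift2_def opC_def)
  qed
  then show ?thesis by (simp add: block_op_hilb Theta_mult[OF l])
qed

end

subsection \<open>Taylor coefficients of Schur functions\<close>

definition taylor_coeff :: "(complex \<Rightarrow> complex) \<Rightarrow> nat \<Rightarrow> complex" where
  "taylor_coeff f n = (deriv ^^ n) f 0 / fact n"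

lemma taylor_coeff_sums:
  assumes "f holomorphic_on ball 0 1" "z \<in> ball 0 1"
  shows "(\<lambda>n. z ^ n * taylor_coeff f n) sums f z"
  using holomorphic_power_series[OF assms] by (simp add: taylor_coeff_def mult.commute)

lemma has_fps_expansion_taylor_coeff:
  assumes "f holomorphic_on ball 0 1"
  shows "f has_fps_expansion Abs_fps (taylor_coeff f)"
  using has_fps_expansion_fps_expansion[OF _ _ assms] by (simp add: fps_expansion_def taylor_coeff_def[abs_def])

lemma taylor_coeff_eq: "f has_fps_expansion F \<Longrightarrow> taylor_coeff f n = fps_nth F n"
  by (simp add: taylor_coeff_def fps_nth_fps_expansion)

lemma taylor_coeff_poly: "taylor_coeff (\<lambda>w. \<Sum>m\<le>N. y m * w ^ m) n = (if n \<le> N then y n else 0)"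
proof -
  have "(\<lambda>w. \<Sum>m\<le>N. y m * w ^ m) has_fps_expansion (\<Sum>m\<le>N. fps_const (y m) * fps_X ^ m)"
    by (intro fps_expansion_intros)
  then have "taylor_coeff (\<lambda>w. \<Sum>m\<le>N. y m * w ^ m) n = (\<Sum>m\<le>N. fps_nth (fps_const (y m) * fps_X ^ m) n)"
    by (simp add: taylor_coeff_eq fps_sum_nth)
  also have "\<dots> = (\<Sum>m\<le>N. if m = n then y m else 0)"
    by (intro sum.cong) (auto simp: fps_X_power_nth)
  finally show ?thesis by simp
qed

lemma taylor_coeff_mult_add:
  assumes "f holomorphic_on ball 0 1" "f' holomorphic_on ball 0 1"
    "g holomorphic_on ball 0 1" "g' holomorphic_on ball 0 1"
  shows "taylor_coeff (\<lambda>w. f w * g w + f' w * g' w) n =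
    (\<Sum>i\<le>n. taylor_coeff f (n - i) * taylor_coeff g i) + (\<Sum>i\<le>n. taylor_coeff f' (n - i) * taylor_coeff g' i)"
proof -
  have "(\<lambda>w. f w * g w + f' w * g' w) has_fps_expansion
      Abs_fps (taylor_coeff g) * Abs_fps (taylor_coeff f) + Abs_fps (taylor_coeff g') * Abs_fps (taylor_coeff f')"
    unfolding mult.commute[of "f _"] mult.commute[of "f' _"]
    by (intro has_fps_expansion_add has_fps_expansion_mult has_fps_expansion_taylor_coeff assms)
  then show ?thesis
    by (subst taylor_coeff_eq, assumption)
      (simp only: fps_add_nth fps_mult_nth fps_nth_Abs_fps atMost_atLeast0, simp only: mult.commute)
qed

section \<open>Mean squares over circles\<close>

definition unit_exp :: "real \<Rightarrow> complex" where
  "unit_exp t = exp (2 * of_real pi * \<i> * of_real t)"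

lemma cmod_unit_exp [simp]: "cmod (unit_exp t) = 1"
  by (simp add: unit_exp_def)

lemma unit_exp_cnj: "unit_exp t * cnj (unit_exp t) = 1"
  by (metis cmod_unit_exp complex_norm_square of_real_1 one_power2)

lemma continuous_on_unit_exp [continuous_intros]: "continuous_on S unit_exp"
  unfolding unit_exp_def by (intro continuous_intros)

lemma continuous_on_circle:
  assumes "h holomorphic_on ball 0 1" "0 < r" "r < 1"
  shows "continuous_on {0..1} (\<lambda>t. h (of_real r * unit_exp t))"
  by (rule continuous_on_compose2[OF holomorphic_on_imp_continuous_on[OF assms(1)]])
    (use assms in \<open>auto intro!: continuous_intros simp: norm_mult\<close>)

text \<open>Cauchy's formula on the circle of radius \<open>r\<close>, with
  \<open>cnj (unit_exp t)\<close> in place of the inverse of \<open>unit_exp t\<close>.\<close>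

lemma has_integral_taylor_coeff:
  assumes h: "h holomorphic_on ball 0 1" and r: "0 < r" "r < 1"
  shows "((\<lambda>t. h (of_real r * unit_exp t) * cnj (unit_exp t) ^ n) has_integral
    (taylor_coeff h n * of_real r ^ n)) {0..1}"
proof -
  have "((\<lambda>u. h u / (u - 0) ^ Suc n) has_contour_integral (2 * pi * \<i>) / fact n * (deriv ^^ n) h 0) (circlepath 0 r)"
  proof (rule Cauchy_has_contour_integral_higher_derivative_circlepath)
    show "continuous_on (cball 0 r) h"
      using r by (intro holomorphic_on_imp_continuous_on holomorphic_on_subset[OF h]) auto
    show "h holomorphic_on ball 0 r" using r by (intro holomorphic_on_subset[OF h]) auto
  qed (use r in auto)
  then have "((\<lambda>t. h (circlepath 0 r t) / (circlepath 0 r t - 0) ^ Suc n * vector_derivative (circlepath 0 r) (at t))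
      has_integral (2 * pi * \<i>) / fact n * (deriv ^^ n) h 0) {0..1}"
    unfolding has_contour_integral .
  moreover have "circlepath 0 r t = of_real r * unit_exp t" for t
    by (simp add: circlepath unit_exp_def)
  moreover have "vector_derivative (circlepath 0 r) (at t) = 2 * pi * \<i> * r * unit_exp t" for t
    by (simp add: vector_derivative_circlepath unit_exp_def)
  moreover have "h w / (of_real r * unit_exp t - 0) ^ Suc n * (2 * pi * \<i> * r * unit_exp t) =
    (2 * pi * \<i> / of_real r ^ n) * (h w * cnj (unit_exp t) ^ n)" for t w
  proof -
    have "inverse (unit_exp t) = cnj (unit_exp t)" using unit_exp_cnj[of t] by (metis inverse_unique)
    moreover have "unit_exp t \<noteq> 0" using unit_exp_cnj[of t] by auto
    ultimately have "cnj (unit_exp t) ^ n = 1 / unit_exp t ^ n" by (metis inverse_eq_divide power_inverse)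
    then show ?thesis using r \<open>unit_exp t \<noteq> 0\<close> by (simp add: power_mult_distrib field_simps)
  qed
  ultimately have "((\<lambda>t. (2 * pi * \<i> / of_real r ^ n) * (h (of_real r * unit_exp t) * cnj (unit_exp t) ^ n))
      has_integral (2 * pi * \<i>) / fact n * (deriv ^^ n) h 0) {0..1}"
    by simp
  from has_integral_mult_right[OF this, of "of_real r ^ n / (2 * pi * \<i>)"] show ?thesis
    using r by (simp add: taylor_coeff_def field_simps)
qed

lemma has_integral_circle_inner:
  assumes h: "h holomorphic_on ball 0 1" and r: "0 < r" "r < 1"
  shows "((\<lambda>t. Re (h (of_real r * unit_exp t) * cnj (\<Sum>n\<le>N. y n * (of_real r * unit_exp t) ^ n))) has_integral
    (\<Sum>n\<le>N. Re (taylor_coeff h n * cnj (y n)) * r ^ (2 * n))) {0..1}"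
proof -
  have "((\<lambda>t. \<Sum>n\<le>N. (cnj (y n) * of_real r ^ n) * (h (of_real r * unit_exp t) * cnj (unit_exp t) ^ n)) has_integral
    (\<Sum>n\<le>N. (cnj (y n) * of_real r ^ n) * (taylor_coeff h n * of_real r ^ n))) {0..1}"
    by (intro has_integral_sum has_integral_mult_right has_integral_taylor_coeff h r) auto
  from has_integral_linear[OF this bounded_linear_Re] show ?thesis
    by (rule has_integral_eq_rhs[OF has_integral_eq[rotated]])
      (auto simp: sum_distrib_left power_mult_distrib power_mult power2_eq_square algebra_simps
        simp flip: of_real_power of_real_mult)
qed

lemma has_integral_circle_poly:
  assumes r: "0 < r" "r < 1"
  shows "((\<lambda>t. (cmod (\<Sum>n\<le>N. y n * (of_real r * unit_exp t) ^ n))\<^sup>2) has_integral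
    (\<Sum>n\<le>N. (cmod (y n))\<^sup>2 * r ^ (2 * n))) {0..1}"
proof -
  have sq: "Re (z * cnj z) = (cmod z)\<^sup>2" for z by (simp flip: complex_norm_square)
  have "(\<lambda>w. \<Sum>n\<le>N. y n * w ^ n) holomorphic_on ball 0 1" by (intro holomorphic_intros)
  moreover have "(\<Sum>n\<le>N. Re (taylor_coeff (\<lambda>w. \<Sum>n\<le>N. y n * w ^ n) n * cnj (y n)) * r ^ (2 * n)) =
      (\<Sum>n\<le>N. (cmod (y n))\<^sup>2 * r ^ (2 * n))"
    by (rule sum.cong) (simp_all only: taylor_coeff_poly atMost_iff if_True sq)
  ultimately show ?thesis
    using has_integral_circle_inner[of "\<lambda>w. \<Sum>n\<le>N. y n * w ^ n", OF _ r, of y N] by (simp only: sq)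
qed

text \<open>The squared distance of \<open>h\<close> from its Taylor polynomial has nonnegative
  mean. The cross term and the square of the polynomial have the same mean
  \<open>?S\<close>.\<close>

lemma Bessel_circle:
  assumes h: "h holomorphic_on ball 0 1" and r: "0 < r" "r < 1"
  shows "(\<Sum>n\<le>N. (cmod (taylor_coeff h n))\<^sup>2 * r ^ (2 * n)) \<le>
    integral {0..1} (\<lambda>t. (cmod (h (of_real r * unit_exp t)))\<^sup>2)"
proof -
  let ?h = "\<lambda>t. h (of_real r * unit_exp t)"
  let ?p = "\<lambda>t. \<Sum>n\<le>N. taylor_coeff h n * (of_real r * unit_exp t) ^ n"
  let ?S = "\<Sum>n\<le>N. (cmod (taylor_coeff h n))\<^sup>2 * r ^ (2 * n)"
  have sq: "Re (z * cnj z) = (cmod z)\<^sup>2" for z by (simp flip: complex_norm_square)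
  have 1: "((\<lambda>t. (cmod (?h t))\<^sup>2) has_integral integral {0..1} (\<lambda>t. (cmod (?h t))\<^sup>2)) {0..1}"
    by (intro integrable_integral integrable_continuous_interval continuous_intros continuous_on_circle h r)
  have 2: "((\<lambda>t. Re (?h t * cnj (?p t))) has_integral ?S) {0..1}"
    using has_integral_circle_inner[OF h r, of "taylor_coeff h" N] by (simp only: sq)
  have 3: "((\<lambda>t. (cmod (?p t))\<^sup>2) has_integral ?S) {0..1}"
    by (rule has_integral_circle_poly[OF r])
  have "((\<lambda>t. (cmod (?h t))\<^sup>2 - 2 * Re (?h t * cnj (?p t)) + (cmod (?p t))\<^sup>2) has_integral
      integral {0..1} (\<lambda>t. (cmod (?h t))\<^sup>2) - 2 * ?S + ?S) {0..1}"
    by (intro has_integral_add has_integral_diff has_integral_mult_right 1 2 3)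
  moreover have "(cmod a)\<^sup>2 - 2 * Re (a * cnj b) + (cmod b)\<^sup>2 \<ge> 0" for a b
  proof -
    have "(cmod a)\<^sup>2 - 2 * Re (a * cnj b) + (cmod b)\<^sup>2 = (cmod (a - b))\<^sup>2"
      by (simp only: cmod_power2) (simp add: power2_eq_square algebra_simps)
    then show ?thesis by simp
  qed
  ultimately have "0 \<le> integral {0..1} (\<lambda>t. (cmod (?h t))\<^sup>2) - 2 * ?S + ?S"
    by (rule has_integral_nonneg)
  then show ?thesis by simp
qed

text \<open>Integrating the pointwise contractivity over circles and letting the radius tend to \<open>1\<close>.\<close>

lemma contractive2_coeff_le:
  fixes y1 y2 :: "nat \<Rightarrow> complex" and N :: nat
  assumes hol: "f11 holomorphic_on ball 0 1" "f12 holomorphic_on ball 0 1"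
      "f21 holomorphic_on ball 0 1" "f22 holomorphic_on ball 0 1"
    and con: "\<And>z. z \<in> ball 0 1 \<Longrightarrow> contractive2 (f11 z) (f12 z) (f21 z) (f22 z)"
  defines "h1 \<equiv> \<lambda>z. f11 z * (\<Sum>n\<le>N. y1 n * z ^ n) + f12 z * (\<Sum>n\<le>N. y2 n * z ^ n)"
    and "h2 \<equiv> \<lambda>z. f21 z * (\<Sum>n\<le>N. y1 n * z ^ n) + f22 z * (\<Sum>n\<le>N. y2 n * z ^ n)"
  shows "(\<Sum>n\<le>N. (cmod (taylor_coeff h1 n))\<^sup>2 + (cmod (taylor_coeff h2 n))\<^sup>2) \<le>
    (\<Sum>n\<le>N. (cmod (y1 n))\<^sup>2 + (cmod (y2 n))\<^sup>2)"
proof -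
  have hh: "h1 holomorphic_on ball 0 1" "h2 holomorphic_on ball 0 1"
    unfolding h1_def h2_def by (intro holomorphic_intros hol)+
  let ?L = "\<lambda>r. \<Sum>n\<le>N. ((cmod (taylor_coeff h1 n))\<^sup>2 + (cmod (taylor_coeff h2 n))\<^sup>2) * r ^ (2 * n)"
  let ?R = "\<lambda>r. \<Sum>n\<le>N. ((cmod (y1 n))\<^sup>2 + (cmod (y2 n))\<^sup>2) * r ^ (2 * n)"
  have le: "?L r \<le> ?R r" if r: "0 < r" "r < 1" for r :: real
  proof -
    let ?p1 = "\<lambda>t. \<Sum>n\<le>N. y1 n * (of_real r * unit_exp t) ^ n"
    let ?p2 = "\<lambda>t. \<Sum>n\<le>N. y2 n * (of_real r * unit_exp t) ^ n"
    let ?I = "\<lambda>h. integral {0..1} (\<lambda>t. (cmod (h (of_real r * unit_exp t)))\<^sup>2)"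
    have "?L r \<le> ?I h1 + ?I h2"
      using Bessel_circle[OF hh(1) r, of N] Bessel_circle[OF hh(2) r, of N]
      by (simp add: sum.distrib distrib_right)
    also have "\<dots> \<le> ?R r"
    proof (rule has_integral_le)
      show "((\<lambda>t. (cmod (h1 (of_real r * unit_exp t)))\<^sup>2 + (cmod (h2 (of_real r * unit_exp t)))\<^sup>2)
          has_integral ?I h1 + ?I h2) {0..1}"
        by (intro has_integral_add integrable_integral integrable_continuous_interval
            continuous_intros continuous_on_circle hh r)
      show "((\<lambda>t. (cmod (?p1 t))\<^sup>2 + (cmod (?p2 t))\<^sup>2) has_integral ?R r) {0..1}"
        using has_integral_add[OF has_integral_circle_poly[OF r, of y1 N] has_integral_circle_poly[OF r, of y2 N]]
        by (simp add: sum.distrib distrib_right)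
      fix t
      have "of_real r * unit_exp t \<in> ball 0 1" using r by (simp add: norm_mult)
      then show "(cmod (h1 (of_real r * unit_exp t)))\<^sup>2 + (cmod (h2 (of_real r * unit_exp t)))\<^sup>2
          \<le> (cmod (?p1 t))\<^sup>2 + (cmod (?p2 t))\<^sup>2"
        using con unfolding h1_def h2_def contractive2_def by blast
    qed
    finally show ?thesis .
  qed
  have "?L 1 \<le> ?R 1"
  proof (rule tendsto_le)
    show "(?L \<longlongrightarrow> ?L 1) (at_left 1)" "(?R \<longlongrightarrow> ?R 1) (at_left 1)"
      by (intro tendsto_intros)+
    show "eventually (\<lambda>r. ?L r \<le> ?R r) (at_left 1)"
      using le eventually_at_left_real[of 0 "1::real"] by (auto elim: eventually_mono)
  qed auto
  then show ?thesis by simp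
qed

section \<open>Contractivity of the adjoint Toeplitz operator\<close>

lemma sum_atMost_odd: "(\<Sum>i\<le>2 * K + 1. g i) = (\<Sum>k\<le>K. g (2 * k) + g (2 * k + 1))" for g :: "nat \<Rightarrow> 'a::comm_monoid_add"
  by (induction K) (simp_all add: algebra_simps)

lemma sum_triangle_swap:
  "(\<Sum>m\<le>L. \<Sum>n=m..L. g m n) = (\<Sum>n\<le>L. \<Sum>m\<le>n. g m n)" for g :: "nat \<Rightarrow> nat \<Rightarrow> 'a::comm_monoid_add"
  by (induction L) (simp_all add: sum.distrib algebra_simps)

text \<open>The scalar places are regrouped in pairs. Letting \<open>n\<close> run up to
  \<open>degree q\<close> overshoots, but the additional coefficients of \<open>q\<close>
  vanish.\<close>

lemma pairing_poly_shift:
  assumes "m \<le> degree q"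
  shows "pairing f (poly_shift (2 * m) q) = (\<Sum>n=m..degree q.
    f (2 * (n - m)) * cnj (coeff q (2 * n)) + f (2 * (n - m) + 1) * cnj (coeff q (2 * n + 1)))"
proof -
  define K where "K = degree q - m"
  have "degree (poly_shift (2 * m) q) \<le> 2 * K + 1"
    by (rule degree_le) (auto simp: coeff_poly_shift K_def intro!: coeff_eq_0)
  from pairing_eq[OF this] have "pairing f (poly_shift (2 * m) q) =
      (\<Sum>k\<le>K. f (2 * k) * cnj (coeff q (2 * k + 2 * m)) + f (2 * k + 1) * cnj (coeff q (2 * k + 1 + 2 * m)))"
    unfolding sum_atMost_odd coeff_poly_shift .
  also have "\<dots> = (\<Sum>n=m..degree q.
      f (2 * (n - m)) * cnj (coeff q (2 * n)) + f (2 * (n - m) + 1) * cnj (coeff q (2 * n + 1)))"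
    using assms
    by (intro sum.reindex_bij_witness[of _ "\<lambda>n. n - m" "\<lambda>k. k + m"]) (auto simp: K_def algebra_simps)
  finally show ?thesis .
qed

definition column_seq :: "(complex \<Rightarrow> complex) \<Rightarrow> (complex \<Rightarrow> complex) \<Rightarrow> nat \<Rightarrow> complex" where
  "column_seq f g i = taylor_coeff (if even i then f else g) (i div 2)"

text \<open>Here \<open>y\<close> is the adjoint of the Toeplitz operator applied to
  \<open>q\<close>, with squared norm \<open>S\<close>. By adjointness \<open>S\<close> is the inner
  product of \<open>H\<close> with \<open>q\<close>, where \<open>H\<close> is the operator applied
  to \<open>y\<close>. By \<open>contractive2_coeff_le\<close> its squared norm up to
  \<open>L\<close> is at most \<open>S\<close>, so the Cauchy-Schwarz inequality gives
  \<open>S * S \<le> S * |q|^2\<close>.\<close>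

lemma contractive_series_column_seq:
  assumes hol: "f11 holomorphic_on ball 0 1" "f12 holomorphic_on ball 0 1"
      "f21 holomorphic_on ball 0 1" "f22 holomorphic_on ball 0 1"
    and con: "\<And>z. z \<in> ball 0 1 \<Longrightarrow> contractive2 (f11 z) (f12 z) (f21 z) (f22 z)"
  shows "contractive_series (\<lambda>a. if a = 1 then column_seq f11 f21 else column_seq f12 f22)"
    (is "contractive_series ?\<Phi>")
proof
  fix q :: "complex poly"
  define L where "L = degree q"
  define y where "y a m = cnj (pairing (?\<Phi> a) (poly_shift (2 * m) q))" for a :: 2 and m
  define S where "S = (\<Sum>m\<le>L. (cmod (y 1 m))\<^sup>2 + (cmod (y 2 m))\<^sup>2)"
  define p where "p a z = (\<Sum>n\<le>L. y a n * z ^ n)" for a z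
  have holp: "p a holomorphic_on ball 0 1" for a
    unfolding p_def[abs_def] by (intro holomorphic_intros)
  define H1 where "H1 = taylor_coeff (\<lambda>z. f11 z * p 1 z + f12 z * p 2 z)"
  define H2 where "H2 = taylor_coeff (\<lambda>z. f21 z * p 1 z + f22 z * p 2 z)"
  have tp: "taylor_coeff (p a) n = y a n" if "n \<le> L" for a n
    using that unfolding p_def[abs_def] by (simp add: taylor_coeff_poly)
  have H1: "H1 n = (\<Sum>m\<le>n. taylor_coeff f11 (n - m) * y 1 m) + (\<Sum>m\<le>n. taylor_coeff f12 (n - m) * y 2 m)"
    and H2: "H2 n = (\<Sum>m\<le>n. taylor_coeff f21 (n - m) * y 1 m) + (\<Sum>m\<le>n. taylor_coeff f22 (n - m) * y 2 m)"
    if "n \<le> L" for n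
    using that tp by (simp_all add: H1_def H2_def taylor_coeff_mult_add hol holp)
  have H_le: "(\<Sum>n\<le>L. (cmod (H1 n))\<^sup>2 + (cmod (H2 n))\<^sup>2) \<le> S"
    unfolding S_def H1_def H2_def p_def by (rule contractive2_coeff_le[OF hol con])
  have "of_real S = (\<Sum>m\<le>L. y 1 m * pairing (?\<Phi> 1) (poly_shift (2 * m) q) + y 2 m * pairing (?\<Phi> 2) (poly_shift (2 * m) q))"
    unfolding S_def of_real_sum of_real_add complex_norm_square by (simp add: y_def)
  also have "\<dots> = (\<Sum>m\<le>L. \<Sum>n=m..L.
      (taylor_coeff f11 (n - m) * y 1 m + taylor_coeff f12 (n - m) * y 2 m) * cnj (coeff q (2 * n)) +
      (taylor_coeff f21 (n - m) * y 1 m + taylor_coeff f22 (n - m) * y 2 m) * cnj (coeff q (2 * n + 1)))"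
  proof (rule sum.cong)
    fix m assume "m \<in> {..L}"
    then have "pairing (column_seq f g) (poly_shift (2 * m) q) = (\<Sum>n=m..L.
        taylor_coeff f (n - m) * cnj (coeff q (2 * n)) + taylor_coeff g (n - m) * cnj (coeff q (2 * n + 1)))" for f g
      using pairing_poly_shift[of m q "column_seq f g"] by (simp add: L_def column_seq_def)
    then show "y 1 m * pairing (?\<Phi> 1) (poly_shift (2 * m) q) + y 2 m * pairing (?\<Phi> 2) (poly_shift (2 * m) q) =
      (\<Sum>n=m..L.
      (taylor_coeff f11 (n - m) * y 1 m + taylor_coeff f12 (n - m) * y 2 m) * cnj (coeff q (2 * n)) +
      (taylor_coeff f21 (n - m) * y 1 m + taylor_coeff f22 (n - m) * y 2 m) * cnj (coeff q (2 * n + 1)))"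
      by (simp add: sum_distrib_left sum.distrib algebra_simps)
  qed simp
  also have "\<dots> = (\<Sum>n\<le>L. \<Sum>m\<le>n.
      (taylor_coeff f11 (n - m) * y 1 m + taylor_coeff f12 (n - m) * y 2 m) * cnj (coeff q (2 * n)) +
      (taylor_coeff f21 (n - m) * y 1 m + taylor_coeff f22 (n - m) * y 2 m) * cnj (coeff q (2 * n + 1)))"
    by (rule sum_triangle_swap)
  also have "\<dots> = (\<Sum>n\<le>L. H1 n * cnj (coeff q (2 * n)) + H2 n * cnj (coeff q (2 * n + 1)))"
    by (rule sum.cong) (simp_all add: H1 H2 sum_distrib_right sum.distrib distrib_right)
  finally have S_eq: "of_real S = (\<Sum>n\<le>L. H1 n * cnj (coeff q (2 * n)) + H2 n * cnj (coeff q (2 * n + 1)))" .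
  have S0: "S \<ge> 0" unfolding S_def by (intro sum_nonneg) auto
  define a where "a n = sqrt ((cmod (H1 n))\<^sup>2 + (cmod (H2 n))\<^sup>2)" for n
  define b where "b n = sqrt ((cmod (coeff q (2 * n)))\<^sup>2 + (cmod (coeff q (2 * n + 1)))\<^sup>2)" for n
  have "S = cmod (\<Sum>n\<le>L. H1 n * cnj (coeff q (2 * n)) + H2 n * cnj (coeff q (2 * n + 1)))"
    unfolding S_eq[symmetric] using S0 by simp
  also have "\<dots> \<le> (\<Sum>n\<le>L. a n * b n)"
  proof (rule sum_norm_le)
    fix n
    have "cmod (H1 n * cnj (coeff q (2 * n)) + H2 n * cnj (coeff q (2 * n + 1))) \<le>
      cmod (H1 n) * cmod (coeff q (2 * n)) + cmod (H2 n) * cmod (coeff q (2 * n + 1))"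
      by (rule order_trans[OF norm_triangle_ineq]) (simp add: norm_mult)
    also have "\<dots> \<le> a n * b n" unfolding a_def b_def by (rule mult_add_le_sqrt)
    finally show "cmod (H1 n * cnj (coeff q (2 * n)) + H2 n * cnj (coeff q (2 * n + 1))) \<le> a n * b n" .
  qed
  finally have "S\<^sup>2 \<le> (\<Sum>n\<le>L. a n * b n)\<^sup>2" using S0 by (intro power_mono)
  also have "\<dots> \<le> (\<Sum>n\<le>L. (a n)\<^sup>2) * (\<Sum>n\<le>L. (b n)\<^sup>2)"
    by (rule Cauchy_Schwarz_ineq_sum)
  also have "\<dots> \<le> S * (\<Sum>n\<le>L. (b n)\<^sup>2)"
    using H_le by (intro mult_right_mono sum_nonneg) (auto simp: a_def)
  also have "(\<Sum>n\<le>L. (b n)\<^sup>2) = (\<Sum>i\<le>2 * L + 1. (cmod (coeff q i))\<^sup>2)"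
    unfolding sum_atMost_odd by (simp add: b_def)
  also have "\<dots> = (\<Sum>i\<le>L. (cmod (coeff q i))\<^sup>2)"
    by (rule sum.mono_neutral_right) (auto simp: L_def coeff_eq_0)
  finally have "S * S \<le> S * (\<Sum>i\<le>L. (cmod (coeff q i))\<^sup>2)" by (simp only: power2_eq_square)
  then have "S = 0 \<or> S \<le> (\<Sum>i\<le>L. (cmod (coeff q i))\<^sup>2)"
    using S0 by (auto simp: mult_le_cancel_left)
  then have "S \<le> (\<Sum>i\<le>L. (cmod (coeff q i))\<^sup>2)"
    by (auto intro!: sum_nonneg)
  then show "(\<Sum>m\<le>degree q. \<Sum>a\<in>UNIV. (cmod (pairing (?\<Phi> a) (poly_shift (2 * m) q)))\<^sup>2)
      \<le> (\<Sum>i\<le>degree q. (cmod (coeff q i))\<^sup>2)"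
    by (simp add: S_def L_def y_def sum_2)
qed

subsection \<open>The realization solves the interpolation inequality\<close>

lemma gram_form:
  "(\<Sum>p\<in>UNIV. \<Sum>q\<in>UNIV. cnj (c p) * (cnj (g p) * g q) * c q) = of_real ((cmod (\<Sum>p\<in>UNIV. c p * g p))\<^sup>2)"
  for c g :: "'a::finite \<Rightarrow> complex"
  unfolding complex_norm_square by (simp add: sum_product mult_ac) (rule sum.swap)

lemma (in semi_inner) inner_prod_form:
  fixes c :: "'a::finite \<Rightarrow> complex"
  assumes v: "\<And>p. v p \<in> space"
  shows "(\<Sum>p\<in>UNIV. \<Sum>q\<in>UNIV. cnj (c p) * inner_prod (v q) (v p) * c q) =
    of_real (normsq (\<lambda>i. \<Sum>p\<in>UNIV. c p * v p i))"
proof -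
  let ?V = "\<lambda>i. \<Sum>p\<in>UNIV. c p * v p i"
  have V: "?V \<in> space" by (intro space_sum space_mult v)
  have "inner_prod ?V ?V = (\<Sum>q\<in>UNIV. c q * inner_prod (v q) ?V)"
    by (rule inner_prod_sum_left) (auto simp: v V)
  also have "\<dots> = (\<Sum>q\<in>UNIV. c q * cnj (\<Sum>p\<in>UNIV. c p * inner_prod (v p) (v q)))"
    using inner_prod_sum_left[where S = UNIV and c = c and v = v, OF v v] inner_prod_cnj[OF V v] by simp
  also have "\<dots> = (\<Sum>q\<in>UNIV. \<Sum>p\<in>UNIV. cnj (c p) * inner_prod (v q) (v p) * c q)"
    by (simp add: sum_distrib_left mult_ac inner_prod_cnj[OF v v, symmetric])
  also have "\<dots> = (\<Sum>p\<in>UNIV. \<Sum>q\<in>UNIV. cnj (c p) * inner_prod (v q) (v p) * c q)"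
    by (rule sum.swap)
  finally show ?thesis using inner_prod_self[OF V] by simp
qed

lemma rank_outer_le_1:
  fixes g :: "'a::finite \<Rightarrow> complex"
  shows "rank (\<chi> p q. cnj (g p) * g q) \<le> 1"
proof -
  let ?N = "\<chi> p q. cnj (g p) * g q"
  have "rows ?N \<subseteq> vec.span {\<chi> q. g q}"
  proof
    fix r assume "r \<in> rows ?N"
    then obtain p where "r = cnj (g p) *s (\<chi> q. g q)"
      by (auto simp: rows_def row_def vec_eq_iff)
    then show "r \<in> vec.span {\<chi> q. g q}" by (simp add: vec.span_base vec.span_scale)
  qed
  then have "vec.dim (rows ?N) \<le> card {\<chi> q. g q}" by (intro vec.dim_le_card) auto
  then show ?thesis by (simp add: row_rank_def_gen)
qed

context contractive_series
begin

text \<open>The quadratic form of the difference of the two sides at \<open>c\<close> is the squared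
  norm of an input of the colligation minus that of its output, where the input is the combination
  with weights \<open>c\<close> of the interpolation inputs. Contractivity makes it
  nonnegative.\<close>

lemma realization_solves_SW:
  fixes lam x1 x2 x3 :: "'n::finite \<Rightarrow> complex" and z :: "3 \<Rightarrow> complex"
    and \<gamma> :: "'n \<Rightarrow> 3 \<Rightarrow> complex"
  assumes lam: "\<And>j. cmod (lam j) < 1"
    and \<gamma>: "\<And>j k. Theta hilb opA head2 opC shift2 (lam j) *v vector [1, z k * \<gamma> j k] =
      vector [Psi (z k) (x1 j) (x2 j) (x3 j), \<gamma> j k]"
  shows "\<exists>N M v. SW_solution lam x1 x2 x3 z N M \<and>
    SW_choices lam x1 x2 x3 z N M \<gamma> hilb v opA head2 opC shift2"
proof -
  define u :: "'n \<Rightarrow> 3 \<Rightarrow> complex ^ 2" where "u j k = vector [1, z k * \<gamma> j k]" for j k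
  define v where "v j k = state (lam j) (u j k)" for j k
  have v: "v j k \<in> space" for j k unfolding v_def by (rule state_space[OF lam])
  define \<psi> where "\<psi> j k = Psi (z k) (x1 j) (x2 j) (x3 j)" for j k
  have block: "block_op hilb opA head2 opC shift2 (u j k, lam j \<odot>\<^bsub>hilb\<^esub> v j k) =
      (vector [\<psi> j k, \<gamma> j k], v j k)" for j k
    unfolding v_def block_op_state[OF lam] u_def \<psi>_def \<gamma> ..
  define N :: "complex ^ ('n \<times> 3) ^ ('n \<times> 3)" where
    "N = (\<chi> p q. cnj (case_prod \<gamma> p) * case_prod \<gamma> q)"
  define M :: "complex ^ ('n \<times> 3) ^ ('n \<times> 3)" where
    "M = (\<chi> p q. inner_prod (case_prod v q) (case_prod v p))"
  have choices: "SW_choices lam x1 x2 x3 z N M \<gamma> hilb v opA head2 opC shift2"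
    unfolding SW_choices_def
    using v block hilbert_space_hilb contraction_blocks_hilb
    by (simp add: N_def M_def u_def \<psi>_def)
  have "pos_semidef N"
    unfolding pos_semidef_def N_def using gram_form[of "\<lambda>p. _ $ p" "case_prod \<gamma>"] by simp
  moreover have "pos_semidef M"
    unfolding pos_semidef_def
  proof
    fix c :: "complex ^ ('n \<times> 3)"
    have cv: "case_prod v p \<in> space" for p using v by (cases p) simp
    have "(\<Sum>p\<in>UNIV. \<Sum>q\<in>UNIV. cnj (c $ p) * M $ p $ q * c $ q) =
        of_real (normsq (\<lambda>i. \<Sum>p\<in>UNIV. c $ p * case_prod v p i))"
      using inner_prod_form[of "case_prod v" "\<lambda>p. c $ p", OF cv] by (simp add: M_def)
    moreover have "(\<lambda>i. \<Sum>p\<in>UNIV. c $ p * case_prod v p i) \<in> space"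
      using cv by (intro space_sum space_mult)
    ultimately show "(\<Sum>p\<in>UNIV. \<Sum>q\<in>UNIV. cnj (c $ p) * M $ p $ q * c $ q) \<in> \<real>\<^sub>\<ge>\<^sub>0"
      using normsq_nonneg by simp
  qed
  moreover have "rank N \<le> 1" unfolding N_def by (rule rank_outer_le_1)
  moreover have "loewner_ge
      (index_matrix (\<lambda>i l j k. 1 - cnj (\<psi> i l) * \<psi> j k))
      (index_matrix (\<lambda>i l j k. (1 - cnj (z l) * z k) * N $ (i, l) $ (j, k)) +
       index_matrix (\<lambda>i l j k. (1 - cnj (lam i) * lam j) * M $ (i, l) $ (j, k)))"
    unfolding loewner_ge_def pos_semidef_def
  proof
    fix c :: "complex ^ ('n \<times> 3)"
    define U where "U p = case_prod u p" for p
    define V where "V p = case_prod v p" for p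
    define G where "G p = case_prod \<gamma> p" for p
    define P where "P p = case_prod \<psi> p" for p
    define Z where "Z p = z (snd p)" for p :: "'n \<times> 3"
    define l where "l p = lam (fst p)" for p :: "'n \<times> 3"
    have V: "V p \<in> space" for p using v by (cases p) (simp add: V_def)
    have U: "U p = vector [1, Z p * G p]" for p by (cases p) (simp add: U_def u_def Z_def G_def)
    have bl: "head2 (\<lambda>i. input_seq (U p) i + l p * V p i) = vector [P p, G p]"
      "shift2 (\<lambda>i. input_seq (U p) i + l p * V p i) = V p" for p
      using block[of "fst p" "snd p"]
      by (cases p, simp add: block_op_hilb U_def V_def l_def P_def G_def)+
    \<comment> \<open>The pair \<open>(w, f)\<close> is the combined input; \<open>head\<close> and
      \<open>shift\<close> compute its image by linearity.\<close>
    define w where "w = (\<Sum>p\<in>UNIV. c $ p *s U p)"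
    define f where "f i = (\<Sum>p\<in>UNIV. c $ p * (l p * V p i))" for i
    have f: "f \<in> space" unfolding f_def[abs_def] by (intro space_sum space_mult V)
    have h: "input_seq w i + f i = (\<Sum>p\<in>UNIV. c $ p * (input_seq (U p) i + l p * V p i))" for i
      by (simp add: w_def f_def input_seq_def sum_distrib_left sum.distrib algebra_simps)
    have head: "head2 (\<lambda>i. input_seq w i + f i) = vector [\<Sum>p\<in>UNIV. c $ p * P p, \<Sum>p\<in>UNIV. c $ p * G p]"
      using bl(1) unfolding h by (simp add: vec_eq_iff forall_2)
    have shift: "shift2 (\<lambda>i. input_seq w i + f i) = (\<lambda>i. \<Sum>p\<in>UNIV. c $ p * V p i)"
      using bl(2) unfolding h by (simp add: fun_eq_iff shift2_def)
    have w: "w = vector [\<Sum>p\<in>UNIV. c $ p * 1, \<Sum>p\<in>UNIV. c $ p * (Z p * G p)]"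
      by (simp add: w_def U vec_eq_iff forall_2)
    define n1 where "n1 = (cmod (\<Sum>p\<in>UNIV. c $ p * 1))\<^sup>2"
    define nP where "nP = (cmod (\<Sum>p\<in>UNIV. c $ p * P p))\<^sup>2"
    define nG where "nG = (cmod (\<Sum>p\<in>UNIV. c $ p * G p))\<^sup>2"
    define nZ where "nZ = (cmod (\<Sum>p\<in>UNIV. c $ p * (Z p * G p)))\<^sup>2"
    have le: "nP + nG + normsq (\<lambda>i. \<Sum>p\<in>UNIV. c $ p * V p i) \<le> n1 + nZ + normsq f"
      using colligation_contractive(2)[OF f, of w] unfolding head shift
      by (simp add: norm_vec2 w n1_def nP_def nG_def nZ_def)
    let ?F = "(\<Sum>p\<in>UNIV. \<Sum>q\<in>UNIV. cnj (c $ p) *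
        (index_matrix (\<lambda>i l j k. 1 - cnj (\<psi> i l) * \<psi> j k) -
        (index_matrix (\<lambda>i l j k. (1 - cnj (z l) * z k) * N $ (i, l) $ (j, k)) +
         index_matrix (\<lambda>i l j k. (1 - cnj (lam i) * lam j) * M $ (i, l) $ (j, k)))) $ p $ q * c $ q)"
    have "?F =
      (\<Sum>p\<in>UNIV. \<Sum>q\<in>UNIV. cnj (c $ p) * (cnj 1 * 1) * c $ q)
      - (\<Sum>p\<in>UNIV. \<Sum>q\<in>UNIV. cnj (c $ p) * (cnj (P p) * P q) * c $ q)
      - (\<Sum>p\<in>UNIV. \<Sum>q\<in>UNIV. cnj (c $ p) * (cnj (G p) * G q) * c $ q)
      + (\<Sum>p\<in>UNIV. \<Sum>q\<in>UNIV. cnj (c $ p) * (cnj (Z p * G p) * (Z q * G q)) * c $ q)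
      - (\<Sum>p\<in>UNIV. \<Sum>q\<in>UNIV. cnj (c $ p) * inner_prod (V q) (V p) * c $ q)
      + (\<Sum>p\<in>UNIV. \<Sum>q\<in>UNIV. cnj (c $ p * l p) * inner_prod (V q) (V p) * (c $ q * l q))"
      unfolding sum.distrib[symmetric] sum_subtractf[symmetric]
      by (intro sum.cong refl)
        (simp add: index_matrix_def N_def M_def P_def G_def Z_def V_def l_def case_prod_beta algebra_simps)
    also have "\<dots> = of_real (n1 - nP - nG + nZ - normsq (\<lambda>i. \<Sum>p\<in>UNIV. c $ p * V p i)
        + normsq (\<lambda>i. \<Sum>p\<in>UNIV. (c $ p * l p) * V p i))"
      unfolding gram_form inner_prod_form[OF V] n1_def nP_def nG_def nZ_def by simp
    also have "(\<lambda>i. \<Sum>p\<in>UNIV. (c $ p * l p) * V p i) = f" by (simp add: f_def[abs_def] mult.assoc)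
    finally have "?F = of_real (n1 - nP - nG + nZ - normsq (\<lambda>i. \<Sum>p\<in>UNIV. c $ p * V p i) + normsq f)" .
    moreover have "0 \<le> n1 - nP - nG + nZ - normsq (\<lambda>i. \<Sum>p\<in>UNIV. c $ p * V p i) + normsq f"
      using le by linarith
    ultimately show "?F \<in> \<real>\<^sub>\<ge>\<^sub>0" by (simp only: nonneg_Reals_of_real_iff)
  qed
  ultimately have "SW_solution lam x1 x2 x3 z N M"
    unfolding SW_solution_def \<psi>_def by blast
  then show ?thesis using choices by blast
qed

end

section \<open>Interpolation data read off from the Schur lift\<close>

theorem theorem9p1:
  fixes lam :: "'n::finite \<Rightarrow> complex"
    and x1 x2 x3 :: "'n \<Rightarrow> complex"
    and z :: "3 \<Rightarrow> complex"
    and x :: "complex \<Rightarrow> complex \<times> complex \<times> complex"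
  assumes "inj lam" and "range lam \<subseteq> unit_disc"
    and "\<And>j. (x1 j, x2 j, x3 j) \<in> closed_tetrablock"
    and "\<And>j. x1 j * x2 j \<noteq> x3 j"
    and "inj z" and "range z \<subseteq> unit_disc"
    and "x \<in> Hol_tetrablock"
    and "\<And>j. x (lam j) = (x1 j, x2 j, x3 j)"
  shows "\<exists>N M :: complex ^ ('n \<times> 3) ^ ('n \<times> 3).
    SW_solution lam x1 x2 x3 z N M \<and>
    (\<exists>\<gamma> (H :: (nat \<Rightarrow> complex) inner_module) v A B C D.
      SW_choices lam x1 x2 x3 z N M \<gamma> H v A B C D \<and>
      (\<forall>l\<in>unit_disc. SW_function H A B C D l = x l))"
proof -
  define X1 X2 X3 where "X1 l = fst (x l)" and "X2 l = fst (snd (x l))" and "X3 l = snd (snd (x l))" for l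
  have x: "x l = (X1 l, X2 l, X3 l)" for l by (simp add: X1_def X2_def X3_def)
  have hol: "X1 holomorphic_on ball 0 1" "X2 holomorphic_on ball 0 1" "X3 holomorphic_on ball 0 1"
    and tet: "\<And>l. l \<in> ball 0 1 \<Longrightarrow> (X1 l, X2 l, X3 l) \<in> closed_tetrablock"
    using assms(7) unfolding Hol_tetrablock_def x[symmetric] X1_def[abs_def] X2_def[abs_def] X3_def[abs_def]
    by auto
  have lam: "lam j \<in> ball 0 1" "cmod (lam j) < 1" for j using assms(2) by (auto simp: image_subset_iff)
  have val: "X1 (lam j) = x1 j" "X2 (lam j) = x2 j" "X3 (lam j) = x3 j" for j
    by (simp_all add: X1_def X2_def X3_def assms(8))
  \<comment> \<open>The index type is nonempty, so some node shows that \<open>X1 * X2 - X3\<close>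
    is not identically zero.\<close>
  obtain f1 f2 where f: "f1 holomorphic_on ball 0 1" "f2 holomorphic_on ball 0 1"
    and con: "\<And>l. l \<in> ball 0 1 \<Longrightarrow> contractive2 (X1 l) (f1 l) (f2 l) (X2 l)"
    and det: "\<And>l. l \<in> ball 0 1 \<Longrightarrow> X1 l * X2 l - f1 l * f2 l = X3 l"
    using schur_lift_of_tetrablock[OF hol tet lam(1)] assms(4) unfolding val by blast
  \<comment> \<open>The columns of the lift are \<open>(X1, f2)\<close> and
    \<open>(f1, X2)\<close>.\<close>
  interpret contractive_series "\<lambda>a. if a = 1 then column_seq X1 f2 else column_seq f1 X2"
    by (rule contractive_series_column_seq[OF hol(1) f hol(2) con])
  let ?T = "Theta hilb opA head2 opC shift2"
  have even: "column_seq f g (2 * k) = taylor_coeff f k" and odd: "column_seq f g (Suc (2 * k)) = taylor_coeff g k"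
    for f g k by (simp_all add: column_seq_def)
  have T: "?T l $ 1 $ 1 = X1 l" "?T l $ 1 $ 2 = f1 l" "?T l $ 2 $ 1 = f2 l" "?T l $ 2 $ 2 = X2 l"
    if l: "l \<in> ball 0 1" for l
  proof -
    have "cmod l < 1" using l by simp
    note sums = Theta_nth[OF this]
    show "?T l $ 1 $ 1 = X1 l" "?T l $ 1 $ 2 = f1 l" "?T l $ 2 $ 1 = f2 l" "?T l $ 2 $ 2 = X2 l"
      using sums(1)[of 1] sums(1)[of 2] sums(2)[of 1] sums(2)[of 2]
        taylor_coeff_sums[OF hol(1) l] taylor_coeff_sums[OF hol(2) l]
        taylor_coeff_sums[OF f(1) l] taylor_coeff_sums[OF f(2) l]
      by (auto simp: even odd dest: sums_unique2)
  qed
  \<comment> \<open>The second row of the interpolation equation determines this value; the first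
    row then yields \<open>Psi\<close> because the determinant of the lift at \<open>lam j\<close>
    is \<open>x3 j\<close>.\<close>
  define \<gamma> where "\<gamma> j k = f2 (lam j) / (1 - x2 j * z k)" for j k
  have \<gamma>: "?T (lam j) *v vector [1, z k * \<gamma> j k] = vector [Psi (z k) (x1 j) (x2 j) (x3 j), \<gamma> j k]" for j k
  proof -
    have "cmod (x2 j) \<le> 1" using closed_tetrablock_cmod_le(1)[OF assms(3)] .
    moreover have "cmod (z k) < 1" using assms(6) by (auto simp: image_subset_iff)
    ultimately have "cmod (x2 j * z k) < 1"
      using mult_right_mono[of "cmod (x2 j)" 1 "cmod (z k)"] by (simp add: norm_mult)
    then have nz: "1 - x2 j * z k \<noteq> 0" by auto
    have x3: "x3 j = x1 j * x2 j - f1 (lam j) * f2 (lam j)"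
      using det[OF lam(1)[of j]] by (simp add: val)
    have Psi: "Psi (z k) (x1 j) (x2 j) (x3 j) = (x1 j - x3 j * z k) / (1 - x2 j * z k)"
      using nz by (simp add: Psi_def divide_simps) (simp add: algebra_simps)
    have 1: "x1 j + f1 (lam j) * (z k * \<gamma> j k) = Psi (z k) (x1 j) (x2 j) (x3 j)"
      unfolding Psi unfolding x3 \<gamma>_def using nz by (simp add: divide_simps) (simp add: algebra_simps)
    have 2: "f2 (lam j) + x2 j * (z k * \<gamma> j k) = \<gamma> j k"
      using nz by (simp add: \<gamma>_def divide_simps) (simp add: algebra_simps)
    show ?thesis
      by (simp add: vec_eq_iff forall_2 matrix_vector_mult_def sum_2 T[OF lam(1)] val 1 2)
  qed
  have "SW_function hilb opA head2 opC shift2 l = x l" if "l \<in> unit_disc" for l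
    using T[OF that] det[OF that] by (simp add: SW_function_def det_2 x)
  moreover obtain N M v where "SW_solution lam x1 x2 x3 z N M"
    "SW_choices lam x1 x2 x3 z N M \<gamma> hilb v opA head2 opC shift2"
    using realization_solves_SW[where lam = lam and z = z and \<gamma> = \<gamma>, OF lam(2) \<gamma>] by blast
  ultimately show ?thesis by blast
qed

end
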